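(* Let $G$ be a $2$-connected graph and $e$ an edge of $G$. Then $G$ has no pair of edge-disjoint cycles whose union contains $e$ if and only if, for some integer $n\ge 1$, $G$ has subgraphs $G_1,\dots,G_n$ and a set $U=\{u_0,\dots,u_n\}$ of $n+1$ distinct vertices such that (a) $G=(G_1\cup\cdots\cup G_n)+e$ and $e\notin E(G_i)$ for $i=1,\dots,n$; (b) $e=u_0u_n$; (c) for each $0\le i<j\le n$ with $\{i,j\}\ne\{0,n\}$, $u_iu_j\notin E(G)$; (d) for each $i=1,\dots,n$, $V(G_i)\cap U=\{u_{i-1},u_i\}$; (e) for $1\le i<j\le n$, $V(G_i)\cap V(G_j)=\emptyset$ if $j>i+1$, and $V(G_i)\cap V(G_{i+1})=\{u_i\}$; (f) for each $i=1,\dots,n$ one of the following holds: (f1) $G_i$ is connected and $V(G_i)=\{u_{i-1},u_i\}$; (f2) $G_i$ is a cycle; (f3) $G_i+u_{i-1}u_i$ (the graph obtained from $G_i$ by adding the edge $u_{i-1}u_i$) is a subdivision of a $3$-connected graph with no pair of edge-disjoint cycles whose union contains $u_{i-1}u_i$.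
   Context: Graphs are finite, without loops or parallel edges. "A pair of edge-disjoint cycles whose union contains $f$" means two cycles with no common edge, one of which contains the edge $f$.
   Formalization: Condition (c) is required only for non-consecutive i, j (as printed it rules out (f1) and fails for a triangle); in (f3) the edge u_{i-1}u_i must not lie in G_i, and the no-pair condition is imposed on G_i+u_{i-1}u_i. *)

theory Defs
  imports Main
begin

datatype 'a graph = Graph (verts: "'a set") (edges: "'a set set")

definition fin_simple_graph :: "'a graph \<Rightarrow> bool" where
  "fin_simple_graph G \<longleftrightarrow> finite (verts G) \<and> (\<forall>f\<in>edges G. f \<subseteq> verts G \<and> card f = 2)"

definition subgraph :: "'a graph \<Rightarrow> 'a graph \<Rightarrow> bool" where
  "subgraph H G \<longleftrightarrow> fin_simple_graph H \<and> verts H \<subseteq> verts G \<and> edges H \<subseteq> edges G"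

definition add_edge :: "'a graph \<Rightarrow> 'a set \<Rightarrow> 'a graph" where
  "add_edge G f = Graph (verts G) (insert f (edges G))"

definition graph_Union :: "nat set \<Rightarrow> (nat \<Rightarrow> 'a graph) \<Rightarrow> 'a graph" where
  "graph_Union I H = Graph (\<Union>i\<in>I. verts (H i)) (\<Union>i\<in>I. edges (H i))"

definition del_verts :: "'a graph \<Rightarrow> 'a set \<Rightarrow> 'a graph" where
  "del_verts G X = Graph (verts G - X) {f \<in> edges G. f \<inter> X = {}}"

definition connected_graph :: "'a graph \<Rightarrow> bool" where
  "connected_graph G \<longleftrightarrow> verts G \<noteq> {} \<and>
     (\<forall>x\<in>verts G. \<forall>y\<in>verts G. (\<lambda>a b. {a, b} \<in> edges G)\<^sup>*\<^sup>* x y)"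

definition k_connected :: "nat \<Rightarrow> 'a graph \<Rightarrow> bool" where
  "k_connected k G \<longleftrightarrow> card (verts G) > k \<and>
     (\<forall>X. X \<subseteq> verts G \<and> card X < k \<longrightarrow> connected_graph (del_verts G X))"

definition cycle_graph :: "'a graph \<Rightarrow> bool" where
  "cycle_graph C \<longleftrightarrow> (\<exists>vs. distinct vs \<and> length vs \<ge> 3 \<and>
     C = Graph (set vs) {{vs ! i, vs ! (Suc i mod length vs)} | i. i < length vs})"

definition disjoint_cycle_pair_through :: "'a graph \<Rightarrow> 'a set \<Rightarrow> bool" where
  "disjoint_cycle_pair_through G f \<longleftrightarrow> (\<exists>C D. cycle_graph C \<and> cycle_graph D \<and>
     subgraph C G \<and> subgraph D G \<and> edges C \<inter> edges D = {} \<and> f \<in> edges C \<union> edges D)"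

text \<open>\<open>subdivision_of H G\<close>: \<open>G\<close> arises from \<open>H\<close> by repeatedly replacing an edge \<open>xy\<close> by a
  path \<open>xwy\<close> through a new vertex \<open>w\<close> (possibly zero times).  The branch vertices of \<open>G\<close>
  are the vertices of \<open>H\<close> themselves, so no isomorphism is needed.\<close>

inductive subdivision_of :: "'a graph \<Rightarrow> 'a graph \<Rightarrow> bool" for H where
  refl: "subdivision_of H H"
| subdivide: "\<lbrakk>subdivision_of H G; {x, y} \<in> edges G; x \<noteq> y; w \<notin> verts G\<rbrakk> \<Longrightarrow>
    subdivision_of H (Graph (insert w (verts G)) (edges G - {{x, y}} \<union> {{x, w}, {w, y}}))"

text \<open>The three possibilities for a part \<open>K\<close> with terminals \<open>x\<close>, \<open>y\<close>.  In the last one \<open>xy\<close>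
  is a genuinely new edge, and the absence of a pair of cycles is asserted of \<open>K + xy\<close>, the
  graph that is certain to contain that edge.\<close>

definition single_edge_part :: "'a graph \<Rightarrow> 'a \<Rightarrow> 'a \<Rightarrow> bool" where
  "single_edge_part K x y \<longleftrightarrow> connected_graph K \<and> verts K = {x, y}"

definition three_connected_part :: "'a graph \<Rightarrow> 'a \<Rightarrow> 'a \<Rightarrow> bool" where
  "three_connected_part K x y \<longleftrightarrow> {x, y} \<notin> edges K \<and>
     (\<exists>H. fin_simple_graph H \<and> k_connected 3 H \<and> subdivision_of H (add_edge K {x, y})) \<and>
     \<not> disjoint_cycle_pair_through (add_edge K {x, y}) {x, y}"

text \<open>In a chain of such parts with terminals \<open>u\<^sub>0, \<dots>, u\<^sub>n\<close>, the requirement that \<open>u\<^sub>i\<close> and \<open>u\<^sub>j\<close> be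
  non-adjacent is imposed for non-consecutive \<open>i\<close>, \<open>j\<close> only.  If it were also imposed on
  consecutive ones, a single-edge part could never occur, and the characterisation would fail
  already for a cycle and for \<open>K\<^sub>2\<^sub>,\<^sub>3\<close>.  For consecutive indices, non-adjacency is part of
  \<^const>\<open>three_connected_part\<close>.\<close>

end

theory Submission
  imports Defs
begin

text \<open>Write \<open>e = xy\<close>. A pair of edge-disjoint cycles through \<open>e\<close> is a cycle of \<open>G - e\<close> together with
  an \<open>x\<close>--\<open>y\<close> path of \<open>G - e\<close> avoiding its edges, so there is no such pair iff deleting the edges of any
  cycle of \<open>G - e\<close> separates \<open>x\<close> from \<open>y\<close>. This property is additive under gluing two graphs at a
  cut vertex that separates \<open>x\<close> from \<open>y\<close>, and \<open>G - e\<close> is a chain of blocks from \<open>x\<close> to \<open>y\<close>; so it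
  suffices to treat a single 2-connected block \<open>B\<close> with terminals \<open>x\<close>, \<open>y\<close>.

  Suppress the vertices of degree 2 of \<open>B\<close> other than \<open>x\<close>, \<open>y\<close> one by one. If the two neighbours of
  such a vertex are adjacent, the resulting triangle must be all of \<open>B\<close>. When no such vertex is left,
  \<open>B + xy\<close> is 3-connected: given a separating pair \<open>a\<close>, \<open>b\<close>, take a side \<open>S\<close> avoiding \<open>x\<close> and \<open>y\<close>.
  Vertices of \<open>S\<close> have degree at least 3, so there is a cycle in \<open>S\<close> together with \<open>a\<close>, whereas \<open>x\<close> and \<open>y\<close>
  are joined by a path that does not meet \<open>S\<close>.\<close>

section \<open>Walks, paths and cycles as edge sets\<close>

text \<open>The relation underlying \<open>connected_graph\<close>, taken over a bare edge set, so
  that deleting a cycle or a vertex merely shrinks the set. It is reflexive at every point, even one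
  outside the graph.\<close>

abbreviation reach :: "'a set set \<Rightarrow> 'a \<Rightarrow> 'a \<Rightarrow> bool" where
  "reach F \<equiv> (\<lambda>a b. {a, b} \<in> F)\<^sup>*\<^sup>*"

lemma reach_sym: "reach F a b \<Longrightarrow> reach F b a"
proof (induction rule: rtranclp_induct)
  case (step y z)
  then have "{z, y} \<in> F" by (simp add: insert_commute)
  then show ?case using step.IH by (rule converse_rtranclp_into_rtranclp)
qed simp

lemma reach_trans: "reach F a b \<Longrightarrow> reach F b c \<Longrightarrow> reach F a c"
  by (rule rtranclp_trans)

lemma reach_mono: "reach F a b \<Longrightarrow> F \<subseteq> F' \<Longrightarrow> reach F' a b"
  by (erule rtranclp_mono[THEN predicate2D, rotated]) auto

text \<open>Serves twice: with \<open>f\<close> the identity, to replace an edge by a walk, and with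
  \<open>f\<close> moving one vertex onto a neighbour, to contract an edge.\<close>

lemma reach_map:
  assumes "reach F a b" and "\<And>p q. {p, q} \<in> F \<Longrightarrow> reach F' (f p) (f q)"
  shows "reach F' (f a) (f b)"
  using assms(1) by induction (auto intro: rtranclp_trans assms(2))

lemma reach_closed:
  assumes "reach F a b" and "a \<in> S" and "\<And>p q. p \<in> S \<Longrightarrow> {p, q} \<in> F \<Longrightarrow> q \<in> S"
  shows "b \<in> S"
  using assms(1) by induction (auto intro: assms(2,3))

lemma reach_vertex: "reach F a b \<Longrightarrow> a \<noteq> b \<Longrightarrow> b \<in> \<Union>F"
  by (induction rule: rtranclp_induct) auto

fun walk_edges :: "'a list \<Rightarrow> 'a set set" where
  "walk_edges (a # b # vs) = insert {a, b} (walk_edges (b # vs))"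
| "walk_edges _ = {}"

lemma walk_edges_append: "walk_edges (xs @ v # ys) = walk_edges (xs @ [v]) \<union> walk_edges (v # ys)"
proof (induction xs)
  case (Cons a xs) then show ?case by (cases xs) auto
qed simp

lemma walk_edges_rev: "walk_edges (rev vs) = walk_edges vs"
proof (induction vs rule: walk_edges.induct)
  case (1 a b vs)
  then show ?case using walk_edges_append[of "rev vs" b "[a]"] by (simp add: insert_commute)
qed simp_all

lemma walk_edges_subset: "f \<in> walk_edges vs \<Longrightarrow> f \<subseteq> set vs"
  by (induction vs rule: walk_edges.induct) auto

lemma walk_edges_Union: "2 \<le> length vs \<Longrightarrow> \<Union>(walk_edges vs) = set vs"
proof (induction vs rule: walk_edges.induct)
  case (1 a b vs) then show ?case by (cases vs) auto
qed auto

lemma walk_edges_nth: "walk_edges vs = {{vs ! i, vs ! Suc i} | i. Suc i < length vs}"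
proof (induction vs rule: walk_edges.induct)
  case (1 a b vs)
  have "{{(a # b # vs) ! i, (a # b # vs) ! Suc i} | i. Suc i < length (a # b # vs)} =
     insert {a, b} {{(b # vs) ! i, (b # vs) ! Suc i} | i. Suc i < length (b # vs)}"
    (is "?L = ?R")
  proof
    show "?L \<subseteq> ?R"
    proof
      fix f assume "f \<in> ?L"
      then obtain i where "f = {(a # b # vs) ! i, (a # b # vs) ! Suc i}" "Suc i < length (a # b # vs)"
        by auto
      then show "f \<in> ?R" by (cases i) auto
    qed
    show "?R \<subseteq> ?L" by (force intro: exI[of _ 0] exI[of _ "Suc _"])
  qed
  with 1 show ?case by simp
qed auto

lemma reach_walk_edges: "p \<in> set vs \<Longrightarrow> reach (walk_edges vs) (hd vs) p"
proof (induction vs rule: walk_edges.induct)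
  case (1 a b vs)
  show ?case
  proof (cases "p = a")
    case False
    with 1 have "reach (walk_edges (b # vs)) b p" by auto
    then have "reach (walk_edges (a # b # vs)) b p" by (rule reach_mono) auto
    then show ?thesis by (auto intro: converse_rtranclp_into_rtranclp)
  qed auto
qed auto

text \<open>The path is built from its end backwards. If the new first vertex already occurs on it,
  the piece before that occurrence is dropped, which keeps the list distinct.\<close>

lemma reach_path:
  assumes "reach F x y"
  obtains ps where "distinct ps" "ps \<noteq> []" "hd ps = x" "last ps = y" "walk_edges ps \<subseteq> F"
proof -
  from assms have "\<exists>ps. distinct ps \<and> ps \<noteq> [] \<and> hd ps = x \<and> last ps = y \<and> walk_edges ps \<subseteq> F"
  proof (induction rule: converse_rtranclp_induct)
    case base then show ?case by (intro exI[of _ "[y]"]) auto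
  next
    case (step x z)
    then obtain ps where ps: "distinct ps" "ps \<noteq> []" "hd ps = z" "last ps = y" "walk_edges ps \<subseteq> F"
      by blast
    show ?case
    proof (cases "x \<in> set ps")
      case True
      then obtain xs ys where "ps = xs @ x # ys" by (meson split_list)
      with ps show ?thesis
        using walk_edges_append[of xs x ys] by (intro exI[of _ "x # ys"]) auto
    next
      case False
      with ps step show ?thesis
        by (intro exI[of _ "x # ps"]) (cases ps; auto)
    qed
  qed
  then show thesis using that by blast
qed

section \<open>Cycles as edge sets: rotating, opening and closing them\<close>

text \<open>Closing the list by repeating its head makes a cycle a special walk. The vertices are
  recovered as \<open>\<Union>C\<close>, so the edge set alone determines the cycle.\<close>

definition is_cyc :: "'a set set \<Rightarrow> bool" where
  "is_cyc C \<longleftrightarrow> (\<exists>vs. distinct vs \<and> 3 \<le> length vs \<and> C = walk_edges (vs @ [hd vs]))"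

lemma closed_walk_edges_nth:
  assumes "vs \<noteq> []"
  shows "{{vs ! i, vs ! (Suc i mod length vs)} | i. i < length vs} = walk_edges (vs @ [hd vs])"
proof -
  have "(vs @ [hd vs]) ! i = vs ! i" "(vs @ [hd vs]) ! Suc i = vs ! (Suc i mod length vs)"
    if "i < length vs" for i
    using that assms by (auto simp: nth_append hd_conv_nth mod_Suc)
  then show ?thesis by (auto simp: walk_edges_nth; metis)
qed

lemma cycle_graph_iff: "cycle_graph C \<longleftrightarrow>
    (\<exists>vs. distinct vs \<and> 3 \<le> length vs \<and> C = Graph (set vs) (walk_edges (vs @ [hd vs])))"
proof -
  have "{{vs ! i, vs ! (Suc i mod length vs)} | i. i < length vs} = walk_edges (vs @ [hd vs])"
    if "3 \<le> length vs" for vs :: "'a list"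
    using that by (intro closed_walk_edges_nth) auto
  then show ?thesis unfolding cycle_graph_def by (intro iff_exI) auto
qed

lemma closed_walk_Union: "vs \<noteq> [] \<Longrightarrow> \<Union>(walk_edges (vs @ [hd vs])) = set vs"
  using walk_edges_Union[of "vs @ [hd vs]"] by (cases vs) auto

lemma cycle_graph_is_cyc:
  "cycle_graph C \<longleftrightarrow> is_cyc (edges C) \<and> verts C = \<Union>(edges C)"
proof
  assume "cycle_graph C"
  then show "is_cyc (edges C) \<and> verts C = \<Union>(edges C)"
    unfolding cycle_graph_iff is_cyc_def using closed_walk_Union
    by (metis graph.sel list.size(3) not_numeral_le_zero)
next
  assume "is_cyc (edges C) \<and> verts C = \<Union>(edges C)"
  then show "cycle_graph C"
    unfolding cycle_graph_iff is_cyc_def using closed_walk_Union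
    by (metis graph.collapse list.size(3) not_numeral_le_zero)
qed

text \<open>The closed walk is cut at \<open>v\<close> and at its old head, and the two pieces
  change places.\<close>

lemma is_cyc_rotate:
  assumes "is_cyc C" and "v \<in> \<Union>C"
  obtains ws where "distinct (v # ws)" "2 \<le> length ws" "C = walk_edges (v # ws @ [v])"
proof -
  from assms(1) obtain vs where vs: "distinct vs" "3 \<le> length vs" "C = walk_edges (vs @ [hd vs])"
    unfolding is_cyc_def by blast
  have "vs \<noteq> []" using vs(2) by auto
  then have "v \<in> set vs" using assms(2) closed_walk_Union[of vs] vs(3) by blast
  then obtain xs ys where xy: "vs = xs @ v # ys" by (meson split_list)
  show thesis
  proof (cases xs)
    case Nil
    then show ?thesis using vs xy by (intro that[of ys]) simp_all
  next
    case (Cons h xs')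
    have "C = walk_edges (v # ys @ h # xs' @ [v])"
      unfolding vs(3) xy Cons using walk_edges_append[of "h # xs'" v "ys @ [h]"]
        walk_edges_append[of "v # ys" h "xs' @ [v]"] by (simp add: Un_commute)
    then show ?thesis using vs(1,2) xy Cons by (intro that[of "ys @ h # xs'"]) auto
  qed
qed

text \<open>When the cycle starts at \<open>a\<close>, its other vertices form a path avoiding
  \<open>a\<close>, so \<open>{a, b}\<close> is the first or the last edge of the closed walk.
  Removing it opens the cycle into a path; which end is \<open>a\<close> stays unspecified.\<close>

lemma is_cyc_through_edge:
  assumes "is_cyc C" and "{a, b} \<in> C"
  obtains ps where "distinct ps" "3 \<le> length ps" "{hd ps, last ps} = {a, b}"
    "C = insert {a, b} (walk_edges ps)"
proof -
  obtain ws where ws: "distinct (a # ws)" "2 \<le> length ws" "C = walk_edges (a # ws @ [a])"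
    using is_cyc_rotate[OF assms(1), of a] assms(2) by blast
  obtain h t where ht: "ws = h # t" using ws(2) by (cases ws) auto
  obtain t' l where tl: "ws = t' @ [l]" using ws(2) by (cases ws rule: rev_cases) auto
  have C1: "C = insert {a, h} (walk_edges (ws @ [a]))" using ws ht by auto
  have C2: "C = insert {a, l} (walk_edges (a # ws))"
    using ws tl walk_edges_append[of "a # t'" l "[a]"] by auto
  have "{a, b} \<notin> walk_edges ws" using walk_edges_subset[of "{a,b}" ws] ws(1) by auto
  then have "{a, b} = {a, h} \<or> {a, b} = {a, l}"
    using assms(2) C2 ht by auto
  then show thesis
  proof
    assume "{a, b} = {a, h}"
    then show thesis using that[of "ws @ [a]"] ws C1 ht by (auto simp: insert_commute)
  next
    assume "{a, b} = {a, l}"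
    then show thesis using that[of "a # ws"] ws C2 tl by (auto simp: insert_commute)
  qed
qed

lemma is_cyc_close_path:
  assumes "distinct ps" and "3 \<le> length ps"
  shows "is_cyc (insert {hd ps, last ps} (walk_edges ps))"
proof -
  obtain t l where "ps = t @ [l]" using assms(2) by (cases ps rule: rev_cases) auto
  then have "walk_edges (ps @ [hd ps]) = insert {hd ps, last ps} (walk_edges ps)"
    using walk_edges_append[of t l "[hd ps]"] by (auto simp: insert_commute)
  then show ?thesis unfolding is_cyc_def using assms by metis
qed

text \<open>With three vertices the last one differs from the second, and all later edges miss the
  first. Hence opening a cycle at an edge really removes that edge.\<close>

lemma ends_not_walk_edge:
  assumes "distinct ps" and "3 \<le> length ps"
  shows "{hd ps, last ps} \<notin> walk_edges ps"
proof -
  obtain a b c r where ps: "ps = a # b # c # r"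
    using assms(2) by (cases ps; cases "tl ps"; cases "tl (tl ps)") auto
  have "last (c # r) \<in> set (c # r)" by (rule last_in_set) simp
  then show ?thesis
    using assms(1) walk_edges_subset[of "{a, last ps}" "b # c # r"] unfolding ps
    by (auto simp: doubleton_eq_iff)
qed

lemma is_cyc_edge_subset: "is_cyc C \<Longrightarrow> f \<in> C \<Longrightarrow> \<exists>a b. a \<noteq> b \<and> f = {a, b}"
proof -
  have *: "distinct vs \<Longrightarrow> f \<in> walk_edges vs \<Longrightarrow> \<exists>a b. a \<noteq> b \<and> f = {a, b}" for vs
    by (induction vs rule: walk_edges.induct) auto
  assume C: "is_cyc C" and f: "f \<in> C"
  obtain vs where vs: "distinct vs" "3 \<le> length vs" "C = walk_edges (vs @ [hd vs])"
    using C unfolding is_cyc_def by blast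
  obtain t l where tl: "vs = t @ [l]" using vs(2) by (cases vs rule: rev_cases) auto
  then have "C = insert {hd vs, l} (walk_edges vs)"
    using vs(3) walk_edges_append[of t l "[hd vs]"] by (auto simp: insert_commute)
  moreover have "hd vs \<noteq> l" using vs tl by (cases t) auto
  ultimately show ?thesis using f * vs(1) by auto
qed

lemma is_cyc_two_neighbours:
  assumes "is_cyc C" and "v \<in> \<Union>C"
  obtains p q where "p \<noteq> q" "{v, p} \<in> C" "{v, q} \<in> C"
proof -
  obtain ws where ws: "distinct (v # ws)" "2 \<le> length ws" "C = walk_edges (v # ws @ [v])"
    using is_cyc_rotate[OF assms] .
  obtain h t l where ht: "ws = h # t @ [l]"
    using ws(2) by (cases ws; cases "tl ws" rule: rev_cases) auto
  have "{v, h} \<in> C" "{l, v} \<in> C"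
    unfolding ws(3) ht using walk_edges_append[of "v # h # t" l "[v]"] by simp_all
  then show thesis using that[of h l] ws(1) ht by (simp add: insert_commute)
qed

lemma is_cyc_nonempty: "is_cyc C \<Longrightarrow> C \<noteq> {}"
proof
  assume "is_cyc C" and C: "C = {}"
  then obtain vs where vs: "3 \<le> length vs" "C = walk_edges (vs @ [hd vs])"
    unfolding is_cyc_def by blast
  have "walk_edges (vs @ [hd vs]) = {}" using C unfolding vs(2) .
  then show False using vs(1) by (cases vs; cases "tl vs") simp_all
qed

text \<open>A cycle has two edges at each of its vertices, a path at most one at its first. So the
  cycle avoids the first vertex and lies in the tail.\<close>

lemma path_no_cycle: "distinct vs \<Longrightarrow> C \<subseteq> walk_edges vs \<Longrightarrow> \<not> is_cyc C"
proof (induction vs rule: walk_edges.induct)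
  case (1 a b vs)
  show ?case
  proof
    assume C: "is_cyc C"
    have "a \<notin> \<Union>C"
    proof
      assume "a \<in> \<Union>C"
      then obtain p q where "p \<noteq> q" "{a, p} \<in> C" "{a, q} \<in> C" using is_cyc_two_neighbours[OF C] by metis
      then have "p = b" "q = b"
        using 1(2,3) walk_edges_subset[of "{a,p}" "b # vs"] walk_edges_subset[of "{a,q}" "b # vs"]
        by (auto simp: doubleton_eq_iff)
      with \<open>p \<noteq> q\<close> show False by simp
    qed
    then have "C \<subseteq> walk_edges (b # vs)" using 1(3) by auto
    with 1 C show False by auto
  qed
qed (use is_cyc_nonempty in auto)

text \<open>Opening \<open>D\<close> at an edge outside \<open>C\<close> would leave
  \<open>C\<close> inside a path.\<close>

lemma is_cyc_subset_eq:
  assumes "is_cyc C" and "is_cyc D" and "C \<subseteq> D"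
  shows "C = D"
proof (rule ccontr)
  assume "C \<noteq> D"
  then obtain f where f: "f \<in> D" "f \<notin> C" using assms(3) by auto
  obtain a b where "f = {a, b}" using is_cyc_edge_subset[OF assms(2) f(1)] by blast
  then obtain ps where "distinct ps" "D = insert f (walk_edges ps)"
    using is_cyc_through_edge[OF assms(2)] f(1) by metis
  then show False using path_no_cycle[of ps C] assms f by auto
qed

section \<open>Cycles separating two vertices\<close>

text \<open>With \<open>F\<close> the edge set of \<open>G - e\<close>, this replaces the absence of
  a pair of cycles through \<open>e\<close>. It involves only an edge set and two terminals, so it
  can be handed on to pieces of the graph. It holds trivially if \<open>F\<close> contains no
  cycle.\<close>

definition cycles_separate :: "'a set set \<Rightarrow> 'a \<Rightarrow> 'a \<Rightarrow> bool" where
  "cycles_separate F x y \<longleftrightarrow> (\<forall>C. is_cyc C \<and> C \<subseteq> F \<longrightarrow> \<not> reach (F - C) x y)"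

lemma cycles_separate_sym: "cycles_separate F x y \<Longrightarrow> cycles_separate F y x"
  unfolding cycles_separate_def using reach_sym by metis

lemma fin_simple_edgeD:
  assumes "fin_simple_graph G" and "{p, q} \<in> edges G"
  shows "p \<in> verts G" "q \<in> verts G" "p \<noteq> q"
  using assms unfolding fin_simple_graph_def by auto

lemma cycle_subgraph:
  assumes "fin_simple_graph G" and "is_cyc C" and "C \<subseteq> edges G"
  shows "cycle_graph (Graph (\<Union>C) C)" "subgraph (Graph (\<Union>C) C) G"
  using assms by (auto simp: cycle_graph_is_cyc subgraph_def fin_simple_graph_def intro: finite_subset)

text \<open>A cycle through \<open>{x, y}\<close>, opened at that edge, is a path from
  \<open>x\<close> to \<open>y\<close>, and such a path closed by the edge is a cycle. The other
  cycle of the pair is the one whose edges are deleted.\<close>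

lemma disjoint_cycle_pair_iff:
  assumes G: "fin_simple_graph G" and e: "{x, y} \<in> edges G"
  shows "disjoint_cycle_pair_through G {x, y} \<longleftrightarrow> \<not> cycles_separate (edges G - {{x, y}}) x y"
proof
  have *: "\<not> cycles_separate (edges G - {{x, y}}) x y"
    if CD: "is_cyc C" "is_cyc D" "C \<subseteq> edges G" "D \<subseteq> edges G" "C \<inter> D = {}" "{x, y} \<in> C" for C D
  proof -
    obtain ps where ps: "distinct ps" "3 \<le> length ps" "{hd ps, last ps} = {x, y}"
      "C = insert {x, y} (walk_edges ps)"
      using is_cyc_through_edge[OF CD(1,6)] .
    have "{x, y} \<notin> walk_edges ps" using ends_not_walk_edge[OF ps(1,2)] ps(3) by simp
    then have sub: "walk_edges ps \<subseteq> edges G - {{x, y}} - D" using CD ps(4) by auto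
    have "last ps \<in> set ps" using ps(2) by (intro last_in_set) auto
    then have "reach (edges G - {{x, y}} - D) (hd ps) (last ps)"
      using reach_mono[OF reach_walk_edges sub] by blast
    moreover have "hd ps = x \<and> last ps = y \<or> hd ps = y \<and> last ps = x"
      using ps(3) by (auto simp: doubleton_eq_iff)
    ultimately have "reach (edges G - {{x, y}} - D) x y" by (metis reach_sym)
    moreover have "D \<subseteq> edges G - {{x, y}}" using CD by auto
    ultimately show ?thesis unfolding cycles_separate_def using CD(2) by blast
  qed
  assume "disjoint_cycle_pair_through G {x, y}"
  then obtain C D where CD: "is_cyc (edges C)" "is_cyc (edges D)" "edges C \<subseteq> edges G"
    "edges D \<subseteq> edges G" "edges C \<inter> edges D = {}" "{x, y} \<in> edges C \<or> {x, y} \<in> edges D"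
    unfolding disjoint_cycle_pair_through_def subgraph_def cycle_graph_is_cyc by blast
  then show "\<not> cycles_separate (edges G - {{x, y}}) x y"
    using *[of "edges C" "edges D"] *[of "edges D" "edges C"] by blast
next
  assume "\<not> cycles_separate (edges G - {{x, y}}) x y"
  then obtain D where D: "is_cyc D" "D \<subseteq> edges G - {{x, y}}" "reach (edges G - {{x, y}} - D) x y"
    unfolding cycles_separate_def by blast
  obtain ps where ps: "distinct ps" "ps \<noteq> []" "hd ps = x" "last ps = y"
    "walk_edges ps \<subseteq> edges G - {{x, y}} - D"
    using reach_path[OF D(3)] .
  have "x \<noteq> y" using fin_simple_edgeD[OF G e] by simp
  \<comment> \<open>A path on two vertices would consist of the deleted edge
    \<open>{x, y}\<close>.\<close>
  then have "3 \<le> length ps" using ps by (cases ps; cases "tl ps"; cases "tl (tl ps)") auto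
  then have C: "is_cyc (insert {x, y} (walk_edges ps))"
    using is_cyc_close_path[OF ps(1)] ps(3,4) by simp
  have sub: "insert {x, y} (walk_edges ps) \<subseteq> edges G" "D \<subseteq> edges G" using ps(5) e D(2) by auto
  have "insert {x, y} (walk_edges ps) \<inter> D = {}" using ps(5) D(2) by auto
  then show "disjoint_cycle_pair_through G {x, y}"
    unfolding disjoint_cycle_pair_through_def
    using cycle_subgraph[OF G C sub(1)] cycle_subgraph[OF G D(1) sub(2)]
    by (intro exI[of _ "Graph _ (insert {x, y} (walk_edges ps))"] exI[of _ "Graph _ D"]) auto
qed

section \<open>Gluing two edge sets at a cut vertex\<close>

text \<open>A walk starting at \<open>v\<close> or off \<open>E2\<close> can enter \<open>E2\<close>
  only through \<open>v\<close>. The last conjunct is the invariant: as long as \<open>v\<close> has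
  not been met, the current vertex lies off \<open>E2\<close>, which forces the next edge into
  \<open>E1\<close>.\<close>

lemma reach_split:
  assumes "reach F w t" and "F \<subseteq> E1 \<union> E2" and "\<Union>E1 \<inter> \<Union>E2 \<subseteq> {v}" and "w \<notin> \<Union>E2 - {v}"
  shows "reach (F \<inter> E1) w v \<or> reach (F \<inter> E1) w t \<and> t \<notin> \<Union>E2 - {v}"
  using assms(1)
proof (induction rule: rtranclp_induct)
  case base then show ?case using assms(4) by simp
next
  case (step p q)
  show ?case
  proof (cases "reach (F \<inter> E1) w v")
    case False
    with step.IH have p: "reach (F \<inter> E1) w p" "p \<notin> \<Union>E2" by auto
    then have "{p, q} \<notin> E2" by auto
    then have pq: "{p, q} \<in> E1" "{p, q} \<in> F" using step.hyps(2) assms(2) by auto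
    then have "reach (F \<inter> E1) w q" using p(1) by (auto intro: rtranclp.rtrancl_into_rtrancl)
    moreover have "q \<in> \<Union>E1" using pq(1) by auto
    ultimately show ?thesis using assms(3) by auto
  qed simp
qed

text \<open>Remove \<open>v\<close> from the cycle, or any vertex if the cycle misses
  \<open>v\<close>. The remaining path is connected and avoids \<open>v\<close>, so it stays on one
  side, and every edge of the cycle has an end on it.\<close>

lemma cycle_one_side:
  assumes C: "is_cyc C" and "C \<subseteq> E1 \<union> E2" and "\<Union>E1 \<inter> \<Union>E2 \<subseteq> {v}"
  shows "C \<subseteq> E1 \<or> C \<subseteq> E2"
proof -
  obtain z where z: "z \<in> \<Union>C" "v \<in> \<Union>C \<longrightarrow> z = v"
  proof (cases "v \<in> \<Union>C")
    case False
    obtain f where "f \<in> C" using is_cyc_nonempty[OF C] by blast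
    then have "\<exists>z. z \<in> \<Union>C" using is_cyc_edge_subset[OF C] by blast
    then show thesis using that False by blast
  qed (use that in blast)
  obtain ws where ws: "distinct (z # ws)" "2 \<le> length ws" "C = walk_edges (z # ws @ [z])"
    using is_cyc_rotate[OF C z(1)] .
  have UC: "\<Union>C = insert z (set ws)" using ws walk_edges_Union[of "z # ws @ [z]"] by auto
  have v: "v \<notin> set ws" using z(2) UC ws(1) by auto
  have sub: "walk_edges ws \<subseteq> C"
  proof -
    obtain h t where ht: "ws = t @ [h]" using ws(2) by (cases ws rule: rev_cases) auto
    have "walk_edges (z # ws @ [z]) = walk_edges (z # ws) \<union> {{h, z}}"
      using walk_edges_append[of "z # t" h "[z]"] ht by simp
    moreover have "walk_edges ws \<subseteq> walk_edges (z # ws)" by (cases ws) auto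
    ultimately show ?thesis using ws(3) by auto
  qed
  have one: "C \<subseteq> A" if AB: "C \<subseteq> A \<union> B" "\<Union>A \<inter> \<Union>B \<subseteq> {v}" "hd ws \<in> \<Union>A" for A B
  proof -
    have in_A: "p \<in> \<Union>A \<and> p \<in> set ws" if "p \<in> set ws" for p
    proof -
      have "reach (walk_edges ws) (hd ws) p" using reach_walk_edges[OF that] .
      then have "p \<in> {p \<in> \<Union>A. p \<in> set ws}"
      proof (rule reach_closed)
        show "hd ws \<in> {p \<in> \<Union>A. p \<in> set ws}" using AB(3) that by (cases ws) auto
      next
        fix p q assume p: "p \<in> {p \<in> \<Union>A. p \<in> set ws}" and pq: "{p, q} \<in> walk_edges ws"
        have "{p, q} \<notin> B" using p AB(2) v by auto
        then have "{p, q} \<in> A" using pq sub AB(1) by auto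
        then show "q \<in> {p \<in> \<Union>A. p \<in> set ws}" using walk_edges_subset[OF pq] by auto
      qed
      then show ?thesis by simp
    qed
    show "C \<subseteq> A"
    proof
      fix f assume f: "f \<in> C"
      then obtain p q where "p \<noteq> q" "f = {p, q}" using is_cyc_edge_subset[OF C] by blast
      then obtain r where r: "r \<in> f" "r \<in> set ws" using f UC by (metis Union_iff insertE insertI1 insertI2)
      then have "r \<in> \<Union>A" "r \<noteq> v" using in_A v by auto
      then have "f \<notin> B" using r AB(2) by auto
      then show "f \<in> A" using f AB(1) by auto
    qed
  qed
  have "hd ws \<in> set ws" using ws(2) by (cases ws) auto
  then have "hd ws \<in> \<Union>C" using UC by simp
  then have "hd ws \<in> \<Union>E1 \<or> hd ws \<in> \<Union>E2" using assms(2) by blast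
  then show ?thesis using one[of E1 E2] one[of E2 E1] assms(2,3) by (auto simp: Un_commute Int_commute)
qed

text \<open>The cycle lies on one side. On that side, a walk from \<open>x\<close> to
  \<open>y\<close> avoiding the cycle already joins the terminal to \<open>v\<close>, against the
  hypothesis on that side.\<close>

lemma cycles_separate_glue:
  assumes "\<Union>E1 \<inter> \<Union>E2 \<subseteq> {v}" and "x \<notin> \<Union>E2 - {v}" and "y \<notin> \<Union>E1 - {v}" and "x \<noteq> y"
    and "cycles_separate E1 x v" and "cycles_separate E2 v y"
  shows "cycles_separate (E1 \<union> E2) x y"
  unfolding cycles_separate_def
proof (intro allI impI notI, elim conjE)
  fix C assume C: "is_cyc C" "C \<subseteq> E1 \<union> E2" and r: "reach (E1 \<union> E2 - C) x y"
  have "C \<subseteq> E1 \<or> C \<subseteq> E2" using cycle_one_side[OF C assms(1)] .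
  then show False
  proof
    assume CE: "C \<subseteq> E1"
    let ?F = "(E1 \<union> E2 - C) \<inter> E1"
    have "reach ?F x v \<or> reach ?F x y" using reach_split[OF r _ assms(1,2)] by blast
    \<comment> \<open>The walk can arrive at \<open>y\<close> inside \<open>E1\<close> only if
      \<open>y\<close> is the gluing vertex.\<close>
    moreover have "y = v" if "reach ?F x y" using reach_vertex[OF that assms(4)] assms(3) by auto
    ultimately have "reach (E1 - C) x v" by (blast intro: reach_mono)
    then show False using assms(5) C CE unfolding cycles_separate_def by blast
  next
    assume CE: "C \<subseteq> E2"
    let ?F = "(E1 \<union> E2 - C) \<inter> E2"
    have i: "\<Union>E2 \<inter> \<Union>E1 \<subseteq> {v}" using assms(1) by blast
    have "reach ?F y v \<or> reach ?F y x" using reach_split[OF reach_sym[OF r] _ i assms(3)] by blast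
    moreover have "x = v" if "reach ?F y x" using reach_vertex[OF that] assms(2,4) by auto
    ultimately have "reach (E2 - C) v y" by (blast intro: reach_mono reach_sym)
    then show False using assms(6) C CE unfolding cycles_separate_def by blast
  qed
qed

section \<open>Chains have the separation property\<close>

definition chain_part :: "'a graph \<Rightarrow> 'a \<Rightarrow> 'a \<Rightarrow> bool" where
  "chain_part K x y \<longleftrightarrow> single_edge_part K x y \<or> cycle_graph K \<or> three_connected_part K x y"

text \<open>A part on two vertices contains no cycle. In a cycle the only cycle is the whole part,
  whose deletion leaves no edge. In the third case \<open>xy\<close> is not an edge of
  \<open>K\<close>, so removing it from \<open>K + xy\<close> gives back \<open>K\<close> and
  \<open>disjoint_cycle_pair_iff\<close> applies.\<close>

lemma cycles_separate_chain_part: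
  assumes K: "fin_simple_graph K" and "x \<noteq> y" and xy: "x \<in> verts K" "y \<in> verts K"
    and "chain_part K x y"
  shows "cycles_separate (edges K) x y"
  using assms(5) unfolding chain_part_def
proof (elim disjE)
  assume "single_edge_part K x y"
  then have "edges K \<subseteq> Pow {x, y}"
    using K unfolding single_edge_part_def fin_simple_graph_def by auto
  then have sub: "\<Union>(edges K) \<subseteq> {x, y}" by auto
  have "\<not> is_cyc C" if "C \<subseteq> edges K" for C
  proof
    assume "is_cyc C"
    then obtain vs where vs: "distinct vs" "3 \<le> length vs" "C = walk_edges (vs @ [hd vs])"
      unfolding is_cyc_def by blast
    have "vs \<noteq> []" using vs(2) by auto
    then have "set vs = \<Union>C" using closed_walk_Union vs(3) by metis
    then have "set vs \<subseteq> {x, y}" using that sub by blast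
    then have "card (set vs) \<le> 2" using card_mono[of "{x, y}" "set vs"] assms(2) by simp
    then show False using vs(1,2) by (simp add: distinct_card)
  qed
  then show ?thesis unfolding cycles_separate_def by blast
next
  assume "cycle_graph K"
  then have K: "is_cyc (edges K)" by (simp add: cycle_graph_is_cyc)
  show ?thesis unfolding cycles_separate_def
  proof (intro allI impI notI, elim conjE)
    fix C assume "is_cyc C" "C \<subseteq> edges K" and r: "reach (edges K - C) x y"
    then have "edges K - C = {}" using is_cyc_subset_eq K by blast
    with reach_vertex[OF r assms(2)] show False by (metis Union_empty empty_iff)
  qed
next
  assume part: "three_connected_part K x y"
  have "fin_simple_graph (add_edge K {x, y})"
    using K xy assms(2) by (auto simp: fin_simple_graph_def add_edge_def)
  then show ?thesis
    using part disjoint_cycle_pair_iff[of "add_edge K {x, y}" x y]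
    by (simp add: three_connected_part_def add_edge_def)
qed

text \<open>The decomposition of \<open>G - e\<close>, with membership of terminals expressed by
  indices. Intersections are bounded from above only, the form that concatenation preserves most
  easily; equality follows because \<open>u i\<close> lies in both neighbouring parts.\<close>

definition chain :: "'a graph \<Rightarrow> nat \<Rightarrow> (nat \<Rightarrow> 'a graph) \<Rightarrow> (nat \<Rightarrow> 'a) \<Rightarrow> bool" where
  "chain K n H u \<longleftrightarrow> 1 \<le> n \<and> K = graph_Union {1..n} H \<and> inj_on u {0..n} \<and>
     (\<forall>i\<in>{1..n}. fin_simple_graph (H i) \<and> chain_part (H i) (u (i - 1)) (u i)) \<and>
     (\<forall>i\<in>{1..n}. \<forall>j\<le>n. u j \<in> verts (H i) \<longleftrightarrow> j = i - 1 \<or> j = i) \<and>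
     (\<forall>i j. 1 \<le> i \<and> i < j \<and> j \<le> n \<longrightarrow>
        verts (H i) \<inter> verts (H j) \<subseteq> (if j = i + 1 then {u i} else {}))"

text \<open>Induction on prefixes of the chain: the next part is glued to the union of the first
  \<open>m\<close> parts at \<open>u m\<close>.\<close>

lemma cycles_separate_chain:
  assumes "chain K n H u"
  shows "cycles_separate (edges K) (u 0) (u n)"
proof -
  have inj: "inj_on u {0..n}" and fin: "\<And>i. i \<in> {1..n} \<Longrightarrow> fin_simple_graph (H i)"
    and part: "\<And>i. i \<in> {1..n} \<Longrightarrow> chain_part (H i) (u (i - 1)) (u i)"
    and U: "\<And>i j. i \<in> {1..n} \<Longrightarrow> j \<le> n \<Longrightarrow> u j \<in> verts (H i) \<longleftrightarrow> j = i - 1 \<or> j = i"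
    and V: "\<And>i j. 1 \<le> i \<Longrightarrow> i < j \<Longrightarrow> j \<le> n \<Longrightarrow>
        verts (H i) \<inter> verts (H j) \<subseteq> (if j = i + 1 then {u i} else {})"
    using assms unfolding chain_def by auto
  have vert: "\<Union>(edges (H i)) \<subseteq> verts (H i)" if "i \<in> {1..n}" for i
    using fin[OF that] by (auto simp: fin_simple_graph_def)
  have H: "cycles_separate (edges (H i)) (u (i - 1)) (u i)" if i: "i \<in> {1..n}" for i
  proof (rule cycles_separate_chain_part[OF fin[OF i]])
    have "i - 1 \<noteq> i" "i - 1 \<in> {0..n}" "i \<in> {0..n}" using i by auto
    then show "u (i - 1) \<noteq> u i" using inj by (meson inj_onD)
    show "u (i - 1) \<in> verts (H i)" "u i \<in> verts (H i)" using U[OF i, of "i - 1"] U[OF i, of i] i by auto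
  qed (rule part[OF i])
  have "cycles_separate (\<Union>i\<in>{1..m}. edges (H i)) (u 0) (u m)" if "1 \<le> m" "m \<le> n" for m
    using that
  proof (induction m rule: dec_induct)
    case base then show ?case using H[of 1] by simp
  next
    case (step m)
    let ?E1 = "\<Union>i\<in>{1..m}. edges (H i)" and ?E2 = "edges (H (Suc m))"
    have m: "1 \<le> m" "Suc m \<le> n" using step by simp_all
    have E1: "\<exists>i\<in>{1..m}. p \<in> verts (H i)" if p: "p \<in> \<Union>?E1" for p
    proof -
      from p obtain i where i: "i \<in> {1..m}" "p \<in> \<Union>(edges (H i))" by blast
      then have "i \<in> {1..n}" using m by simp
      then show ?thesis using vert[of i] i by blast
    qed
    have E2: "\<Union>?E2 \<subseteq> verts (H (Suc m))" using vert[of "Suc m"] m by simp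
    \<comment> \<open>Of the first \<open>m\<close> parts only the last one meets the next part, and
      only in \<open>u m\<close>.\<close>
    have 1: "\<Union>?E1 \<inter> \<Union>?E2 \<subseteq> {u m}"
    proof
      fix p assume "p \<in> \<Union>?E1 \<inter> \<Union>?E2"
      then obtain i where i: "i \<in> {1..m}" "p \<in> verts (H i)" "p \<in> verts (H (Suc m))"
        using E1 E2 by blast
      then show "p \<in> {u m}" using V[of i "Suc m"] m by (cases "i = m") auto
    qed
    have 2: "u 0 \<notin> \<Union>?E2 - {u m}" using U[of "Suc m" 0] E2 m by auto
    have 3: "u (Suc m) \<notin> \<Union>?E1 - {u m}"
    proof
      assume "u (Suc m) \<in> \<Union>?E1 - {u m}"
      then obtain i where "i \<in> {1..m}" "u (Suc m) \<in> verts (H i)" using E1 by blast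
      then show False using U[of i "Suc m"] m by auto
    qed
    have "u 0 \<noteq> u (Suc m)" using inj_onD[OF inj, of 0 "Suc m"] m by auto
    then have "cycles_separate (?E1 \<union> ?E2) (u 0) (u (Suc m))"
      using cycles_separate_glue[OF 1 2 3] step.IH H[of "Suc m"] m by simp
    moreover have "(\<Union>i\<in>{1..Suc m}. edges (H i)) = ?E1 \<union> ?E2" by (simp add: atLeastAtMostSuc_conv Un_commute)
    ultimately show ?case by simp
  qed
  then show ?thesis using assms unfolding chain_def graph_Union_def by simp
qed

section \<open>Two-connected parts\<close>

text \<open>Both ends of a longest path in \<open>insert a S\<close> have all their neighbours on that path, and
  one of the ends lies in \<open>S\<close>.\<close>

lemma cycle_exists:
  assumes S: "finite S" "S \<noteq> {}"
    and nb: "\<And>s. s \<in> S \<Longrightarrow> \<exists>p q. p \<noteq> q \<and> p \<noteq> s \<and> q \<noteq> s \<and> {s, p} \<in> E \<and> {s, q} \<in> E \<and>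
      p \<in> insert a S \<and> q \<in> insert a S"
  obtains C where "is_cyc C" "C \<subseteq> E" "\<Union>C \<subseteq> insert a S"
proof -
  define P where "P ps \<longleftrightarrow> distinct ps \<and> set ps \<subseteq> insert a S \<and> walk_edges ps \<subseteq> E" for ps
  obtain s p where sp: "s \<in> S" "p \<noteq> s" "{s, p} \<in> E" "p \<in> insert a S" using S(2) nb by blast
  then have P0: "P [s, p]" unfolding P_def by auto
  have len: "length ps \<le> card (insert a S)" if "P ps" for ps
    using that S(1) card_mono[of "insert a S" "set ps"] unfolding P_def by (simp add: distinct_card)
  obtain ps where ps: "P ps" and max: "\<And>qs. P qs \<Longrightarrow> length qs \<le> length ps"
    using ex_has_greatest_nat[of P, OF P0, of length "Suc (card (insert a S))"] len
    by (metis le_imp_less_Suc)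
  have two: "2 \<le> length ps" using max[OF P0] by simp
  obtain qs where qs: "P qs" "length qs = length ps" "hd qs \<in> S"
  proof (cases "hd ps \<in> S")
    case True then show thesis using that ps by blast
  next
    case False
    obtain h t where ht: "ps = h # t" "t \<noteq> []" using two by (cases ps; cases "tl ps") auto
    obtain r' l where rl: "t = r' @ [l]" using ht(2) by (cases t rule: rev_cases) auto
    have "h = a" using False ps ht(1) unfolding P_def by simp
    then have r: "ps = a # r' @ [l]" using ht rl by simp
    have "P (rev ps)" using ps unfolding P_def by (simp add: walk_edges_rev)
    moreover have "l \<in> S" using ps r unfolding P_def by auto
    ultimately show thesis using that[of "rev ps"] r by simp
  qed
  obtain s' r where r: "qs = s' # r" "r \<noteq> []" using qs(2) two by (cases qs; cases "tl qs") auto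
  have s': "s' \<in> S" using qs(3) r by simp
  have in_r: "p \<in> set r" if "{s', p} \<in> E" "p \<noteq> s'" "p \<in> insert a S" for p
  proof (rule ccontr)
    assume "p \<notin> set r"
    then have "P (p # qs)" using that qs(1) r unfolding P_def by (auto simp: insert_commute)
    then show False using max qs(2) by fastforce
  qed
  \<comment> \<open>A neighbour of the end \<open>s'\<close> other than the second vertex of the
    path: the segment up to \<open>p\<close> then has at least three vertices and closes to a
    cycle.\<close>
  obtain p where p: "{s', p} \<in> E" "p \<in> set r" "p \<noteq> hd r"
    using nb[OF s'] in_r by metis
  obtain r1 r2 where r12: "r = r1 @ p # r2" using split_list[OF p(2)] by blast
  have r1: "r1 \<noteq> []" using p(3) r12 by (cases r1) auto
  let ?vs = "s' # r1 @ [p]"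
  have qs': "qs = s' # r1 @ p # r2" using r r12 by simp
  then have "walk_edges ?vs \<subseteq> walk_edges qs"
    using walk_edges_append[of "s' # r1" p r2] by simp
  then have sub: "walk_edges ?vs \<subseteq> E" using qs(1) unfolding P_def by blast
  have "distinct ?vs" "3 \<le> length ?vs" using qs(1) qs' r1 unfolding P_def by (cases r1; simp)+
  then have C: "is_cyc (insert {s', p} (walk_edges ?vs))"
    using is_cyc_close_path[of ?vs] by simp
  have "set ?vs \<subseteq> insert a S" using qs(1) qs' unfolding P_def by simp
  then have "\<Union>(insert {s', p} (walk_edges ?vs)) \<subseteq> insert a S"
    using walk_edges_subset[of _ ?vs] by auto
  then show thesis using that[OF C] sub p(1) by blast
qed

text \<open>Open the cycle at \<open>ab\<close>, put \<open>w\<close> in front of the path and close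
  it again.\<close>

lemma is_cyc_subdivide:
  assumes "is_cyc C" and "{a, b} \<in> C" and "w \<notin> \<Union>C"
  shows "is_cyc (C - {{a, b}} \<union> {{a, w}, {w, b}})"
proof -
  obtain ps where ps: "distinct ps" "3 \<le> length ps" "{hd ps, last ps} = {a, b}"
    "C = insert {a, b} (walk_edges ps)"
    using is_cyc_through_edge[OF assms(1,2)] .
  have "set ps = \<Union>(walk_edges ps)" using walk_edges_Union[of ps] ps(2) by simp
  then have w: "w \<notin> set ps" using assms(3) ps(4) by auto
  obtain t l where tl: "ps = t @ [l]" using ps(2) by (cases ps rule: rev_cases) auto
  have "walk_edges (w # ps) = insert {w, hd ps} (walk_edges ps)" using ps(2) by (cases ps) auto
  then have "insert {hd (w # ps), last (w # ps)} (walk_edges (w # ps))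
      = {{w, hd ps}, {last ps, w}} \<union> walk_edges ps"
    using tl by (simp add: insert_commute)
  also have "{{w, hd ps}, {last ps, w}} = {{a, w}, {w, b}}"
    using ps(3) by (auto simp: doubleton_eq_iff)
  also have "walk_edges ps = C - {{a, b}}"
    using ends_not_walk_edge[OF ps(1,2)] ps(3,4) by simp
  finally have "insert {hd (w # ps), last (w # ps)} (walk_edges (w # ps))
      = C - {{a, b}} \<union> {{a, w}, {w, b}}" by (simp only: Un_commute)
  moreover have "distinct (w # ps)" "3 \<le> length (w # ps)" using ps w by simp_all
  ultimately show ?thesis using is_cyc_close_path by metis
qed

section \<open>Two-connectedness and separating pairs\<close>

lemma two_connected_iff:
  assumes "fin_simple_graph B"
  shows "k_connected 2 B \<longleftrightarrow> 2 < card (verts B) \<and>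
    (\<forall>p\<in>verts B. \<forall>q\<in>verts B. reach (edges B) p q) \<and>
    (\<forall>z\<in>verts B. \<forall>p\<in>verts B - {z}. \<forall>q\<in>verts B - {z}. reach {f \<in> edges B. z \<notin> f} p q)"
    (is "_ \<longleftrightarrow> ?card \<and> ?con \<and> ?cut")
proof -
  have fin: "finite (verts B)" using assms by (simp add: fin_simple_graph_def)
  have X: "(\<forall>X. X \<subseteq> verts B \<and> card X < 2 \<longrightarrow> Q X) \<longleftrightarrow> Q {} \<and> (\<forall>z\<in>verts B. Q {z})" for Q
  proof -
    have *: "X = {} \<or> (\<exists>z\<in>verts B. X = {z})" if "X \<subseteq> verts B" "card X < 2" for X
    proof -
      have "card X = 0 \<or> card X = 1" using that(2) by auto
      \<comment> \<open>Finiteness rules out infinite sets, whose \<open>card\<close> is 0 by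
        convention.\<close>
      then show ?thesis using that(1) finite_subset[OF that(1) fin] by (auto simp: card_1_singleton_iff)
    qed
    show ?thesis
    proof (intro iffI conjI ballI allI impI)
      assume Q: "\<forall>X. X \<subseteq> verts B \<and> card X < 2 \<longrightarrow> Q X"
      show "Q {}" using Q by simp
      show "Q {z}" if "z \<in> verts B" for z using Q that by simp
    next
      fix X assume "Q {} \<and> (\<forall>z\<in>verts B. Q {z})" and "X \<subseteq> verts B \<and> card X < 2"
      then show "Q X" using *[of X] by auto
    qed
  qed
  have ne: "verts B \<noteq> {}" "verts B - {z} \<noteq> {}" if ?card for z
  proof -
    have "card {z} < card (verts B)" using that by simp
    then show "verts B - {z} \<noteq> {}" "verts B \<noteq> {}" using card_mono[of "{z}" "verts B"] by auto
  qed
  show ?thesis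
    unfolding k_connected_def X connected_graph_def del_verts_def
    using ne by auto
qed

lemma two_connectedD:
  assumes "fin_simple_graph B" and "k_connected 2 B"
  shows "2 < card (verts B)"
    and "\<And>p q. p \<in> verts B \<Longrightarrow> q \<in> verts B \<Longrightarrow> reach (edges B) p q"
    and "\<And>p q z. z \<in> verts B \<Longrightarrow> p \<in> verts B - {z} \<Longrightarrow> q \<in> verts B - {z} \<Longrightarrow>
      reach {f \<in> edges B. z \<notin> f} p q"
  using assms two_connected_iff by blast+

lemma ex_other_vertex:
  assumes "2 < card V" shows "\<exists>t\<in>V. t \<noteq> p \<and> t \<noteq> q"
proof (rule ccontr)
  assume "\<not> ?thesis"
  then have "V \<subseteq> {p, q}" by auto
  then have "card V \<le> card {p, q}" by (intro card_mono) auto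
  also have "\<dots> \<le> 2" by (simp add: card_insert_if)
  finally show False using assms by simp
qed

text \<open>One neighbour \<open>a\<close> comes from connectedness, a second from connectedness
  after deleting \<open>a\<close>.\<close>

lemma two_connected_neighbours:
  assumes B: "fin_simple_graph B" "k_connected 2 B" and w: "w \<in> verts B"
  obtains a b where "a \<noteq> b" "{w, a} \<in> edges B" "{w, b} \<in> edges B"
proof -
  note con = two_connectedD[OF B]
  obtain t where t: "t \<in> verts B" "t \<noteq> w" using ex_other_vertex[OF con(1)] by blast
  obtain a where a: "{w, a} \<in> edges B" using con(2)[OF w t(1)] t(2) by (auto elim: converse_rtranclpE)
  then have a': "a \<in> verts B" "a \<noteq> w" using fin_simple_edgeD[OF B(1) a] by auto
  obtain t' where t': "t' \<in> verts B" "t' \<noteq> w" "t' \<noteq> a" using ex_other_vertex[OF con(1)] by blast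
  have "reach {f \<in> edges B. a \<notin> f} w t'" using con(3)[OF a'(1)] w t' a'(2) by auto
  then obtain b where "{w, b} \<in> edges B" "a \<notin> {w, b}" using t'(2) by (auto elim: converse_rtranclpE)
  then show thesis using that[of a b] a by auto
qed

text \<open>Deleting one vertex of the pair leaves a walk from any vertex of \<open>T\<close> to the
  other one. Up to its first arrival there it stays in \<open>T\<close>, so it avoids both
  \<open>S\<close> and the edge \<open>ab\<close>. Doing this for \<open>a\<close> and for
  \<open>b\<close> joins everything through \<open>T\<close>.\<close>

lemma reach_beside_separation:
  assumes B: "fin_simple_graph B" "k_connected 2 B"
    and V: "verts B = S \<union> T \<union> {a, b}" "a \<noteq> b" "a \<notin> S \<union> T" "b \<notin> S \<union> T" "S \<inter> T = {}" "T \<noteq> {}"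
    and ST: "\<And>s t. s \<in> S \<Longrightarrow> t \<in> T \<Longrightarrow> {t, s} \<notin> edges B"
    and pq: "p \<in> T \<union> {a, b}" "q \<in> T \<union> {a, b}"
  shows "reach {f \<in> edges B. f \<inter> S = {} \<and> f \<noteq> {a, b}} p q" (is "reach ?F p q")
proof -
  have side: "reach ?F t c" if cd: "{c, d} = {a, b}" and t: "t \<in> T" for c d t
  proof -
    have cd': "c \<noteq> d" "c \<notin> S \<union> T" "d \<notin> S \<union> T" "c \<in> verts B" "d \<in> verts B"
      using cd V by (auto simp: doubleton_eq_iff)
    have step: "reach ?F t c \<or> reach ?F t r \<and> r \<in> T" if "reach {f \<in> edges B. d \<notin> f} t r" for r
      using that
    proof (induction rule: rtranclp_induct)
      case base then show ?case using t by simp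
    next
      case (step r r')
      show ?case
      proof (cases "reach ?F t c")
        case False
        with step.IH have r: "reach ?F t r" "r \<in> T" by auto
        have e: "{r, r'} \<in> edges B" "r' \<noteq> d" using step.hyps(2) by auto
        have r': "r' \<in> verts B" "r' \<notin> S" using fin_simple_edgeD[OF B(1) e(1)] ST r(2) e(1) by blast+
        then have r'': "r' \<in> T \<or> r' = c" using V(1) cd e(2) by (auto simp: doubleton_eq_iff)
        have "r \<noteq> a" "r \<noteq> b" "r \<notin> S" using r(2) V(3-5) by auto
        then have "{r, r'} \<in> ?F" using e(1) r'(2) by (auto simp: doubleton_eq_iff)
        then have "reach ?F t r'" using r(1) by (meson rtranclp.rtrancl_into_rtrancl)
        then show ?thesis using r'' by auto
      qed simp
    qed
    have "reach {f \<in> edges B. d \<notin> f} t c"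
      using two_connectedD(3)[OF B cd'(5)] cd' t V(1) by auto
    then show ?thesis using step cd'(2) by blast
  qed
  obtain t where t: "t \<in> T" using V(6) by blast
  have "reach ?F r t" if r: "r \<in> T \<union> {a, b}" for r
  proof -
    consider "r \<in> T" | "r = a" | "r = b" using r by blast
    then show ?thesis
    proof cases
      case 1
      have "reach ?F r a" "reach ?F t a" using side[of a b] 1 t by auto
      then show ?thesis by (blast intro: reach_trans reach_sym)
    next
      case 2 then show ?thesis using reach_sym[OF side[of a b t]] t by simp
    next
      case 3 then show ?thesis using reach_sym[OF side[of b a t]] t by (simp add: insert_commute)
    qed
  qed
  then have "reach ?F p t" "reach ?F q t" using pq by blast+
  then show ?thesis by (blast intro: reach_trans reach_sym)
qed

section \<open>Suppressing a vertex of degree two\<close>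

text \<open>If \<open>{a, b}\<close> is already an edge, the new edge is absorbed by the set. So
  this inverts a subdivision only when \<open>a\<close> and \<open>b\<close> are non-adjacent; the
  adjacent case is \<open>triangle\<close>.\<close>

definition suppress :: "'a graph \<Rightarrow> 'a \<Rightarrow> 'a \<Rightarrow> 'a \<Rightarrow> 'a graph" where
  "suppress B w a b = Graph (verts B - {w}) (insert {a, b} {f \<in> edges B. w \<notin> f})"

locale degree_two_vertex =
  fixes B :: "'a graph" and w a b :: 'a
  assumes fin_simple: "fin_simple_graph B" and two_connected: "k_connected 2 B"
    and w: "w \<in> verts B" and a_neq_b: "a \<noteq> b"
    and nbrs: "{f \<in> edges B. w \<in> f} = {{w, a}, {w, b}}"
begin

lemma wa: "{w, a} \<in> edges B" and wb: "{w, b} \<in> edges B"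
  using nbrs by auto

lemma verts_ab: "a \<in> verts B" "b \<in> verts B" "a \<noteq> w" "b \<noteq> w"
  using fin_simple_edgeD[OF fin_simple wa] fin_simple_edgeD[OF fin_simple wb] by auto

lemma nbr_cases: "{w, s} \<in> edges B \<Longrightarrow> s = a \<or> s = b"
proof -
  assume "{w, s} \<in> edges B"
  then have "{w, s} \<in> {{w, a}, {w, b}}" unfolding nbrs[symmetric] by simp
  then show ?thesis by (auto simp: doubleton_eq_iff)
qed

text \<open>If there were a vertex besides \<open>a\<close>, \<open>b\<close>, \<open>w\<close>, the
  pair \<open>{a, b}\<close> would separate it from \<open>w\<close>, and \<open>x\<close> and
  \<open>y\<close> would be joined avoiding both \<open>w\<close> and the edge \<open>ab\<close>,
  hence avoiding all edges of the triangle.\<close>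

lemma triangle:
  assumes xy: "x \<in> verts B" "y \<in> verts B" "x \<noteq> w" "y \<noteq> w"
    and good: "cycles_separate (edges B) x y" and ab: "{a, b} \<in> edges B"
  shows "cycle_graph B"
proof -
  define C where "C = {{a, b}, {b, w}, {w, a}}"
  have C: "is_cyc C" unfolding is_cyc_def C_def
    using a_neq_b verts_ab by (intro exI[of _ "[a, b, w]"]) auto
  have CB: "C \<subseteq> edges B" using ab wa wb unfolding C_def by (auto simp: insert_commute)
  have "verts B = {a, b, w}"
  proof (rule ccontr)
    assume "verts B \<noteq> {a, b, w}"
    then have T: "verts B - {a, b, w} \<noteq> {}" using verts_ab w by auto
    have "reach {f \<in> edges B. f \<inter> {w} = {} \<and> f \<noteq> {a, b}} x y"
      by (rule reach_beside_separation[OF fin_simple two_connected, of _ "verts B - {a, b, w}"])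
        (use verts_ab w xy T a_neq_b nbr_cases in \<open>auto simp: insert_commute\<close>)
    then have "reach (edges B - C) x y" by (rule reach_mono) (auto simp: C_def)
    then show False using good C CB unfolding cycles_separate_def by blast
  qed
  moreover have "f \<in> C" if f: "f \<in> edges B" for f
  proof (cases "w \<in> f")
    case True
    then have "f \<in> {{w, a}, {w, b}}" using nbrs f by blast
    then show ?thesis unfolding C_def by (auto simp: insert_commute)
  next
    case False
    have "f \<subseteq> {a, b}" "card f = 2" using f False fin_simple \<open>verts B = _\<close>
      unfolding fin_simple_graph_def by auto
    then have "f = {a, b}" using a_neq_b by (intro card_subset_eq) auto
    then show ?thesis unfolding C_def by simp
  qed
  ultimately have "edges B = C" "verts B = \<Union>C" using CB unfolding C_def by auto
  then show ?thesis using C by (simp add: cycle_graph_is_cyc)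
qed

text \<open>Contract \<open>w\<close> onto its neighbour \<open>c\<close>. An edge from
  \<open>w\<close> to \<open>s\<close> becomes trivial for \<open>s = c\<close> and otherwise
  becomes \<open>ab\<close>. Leaving \<open>c\<close> open allows it to be chosen different from a
  deleted vertex.\<close>

lemma reach_suppress:
  assumes "reach F p q" and "F \<subseteq> edges B" and "p \<noteq> w" "q \<noteq> w" and c: "c \<in> {a, b}"
    and F': "{f \<in> F. w \<notin> f} \<subseteq> F'"
    and ab: "\<And>s. s \<in> {a, b} \<Longrightarrow> {w, s} \<in> F \<Longrightarrow> s = c \<or> {a, b} \<in> F'"
  shows "reach F' p q"
proof -
  let ?g = "\<lambda>r. if r = w then c else r"
  have cs: "reach F' c s \<and> reach F' s c" if ws: "{w, s} \<in> F" for s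
  proof -
    have s: "s \<in> {a, b}" using nbr_cases ws assms(2) by auto
    then consider "s = c" | "{c, s} = {a, b}" "{a, b} \<in> F'" using ab[OF s ws] c by auto
    then show ?thesis
    proof cases
      case 2
      then have "reach F' c s" by (simp add: r_into_rtranclp)
      then show ?thesis using reach_sym by metis
    qed simp
  qed
  have "reach F' (?g p) (?g q)"
    using assms(1)
  proof (rule reach_map)
    fix r s assume rs: "{r, s} \<in> F"
    then have "r \<noteq> s" using fin_simple_edgeD[OF fin_simple] assms(2) by blast
    then consider "r = w" "s \<noteq> w" | "s = w" "r \<noteq> w" | "r \<noteq> w" "s \<noteq> w" by blast
    then show "reach F' (?g r) (?g s)"
    proof cases
      case 1 then show ?thesis using cs[of s] rs by simp
    next
      case 2 then show ?thesis using cs[of r] rs by (simp add: insert_commute)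
    next
      case 3
      then have "{r, s} \<in> F'" using rs F' by auto
      then show ?thesis using 3 by (simp add: r_into_rtranclp)
    qed
  qed
  then show ?thesis using assms(3,4) by simp
qed

lemma fin_simple_suppress: "fin_simple_graph (suppress B w a b)"
  using fin_simple verts_ab a_neq_b unfolding fin_simple_graph_def suppress_def by auto

lemma two_connected_suppress:
  assumes ab: "{a, b} \<notin> edges B"
  shows "k_connected 2 (suppress B w a b)"
proof -
  let ?E = "insert {a, b} {f \<in> edges B. w \<notin> f}"
  note con = two_connectedD[OF fin_simple two_connected]
  \<comment> \<open>Without \<open>w\<close>, the vertices \<open>a\<close> and \<open>b\<close> are
    still connected; as they are non-adjacent, this takes a fourth vertex. So at least three
    vertices survive the suppression.\<close>
  have "verts B \<noteq> {a, b, w}"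
  proof
    assume V: "verts B = {a, b, w}"
    have "reach {f \<in> edges B. w \<notin> f} a b" using con(3)[OF w] verts_ab by auto
    then obtain c where c: "{a, c} \<in> edges B" "c \<noteq> w"
      using a_neq_b by (auto elim: converse_rtranclpE)
    then have "c = b" using fin_simple_edgeD[OF fin_simple c(1)] V by auto
    then show False using c ab by simp
  qed
  then obtain t where t: "t \<in> verts B" "t \<notin> {a, b, w}" using verts_ab w by auto
  have "card {t, a, b} \<le> card (verts B - {w})"
    using t verts_ab fin_simple by (intro card_mono) (auto simp: fin_simple_graph_def)
  moreover have "card {t, a, b} = 3" using t a_neq_b by auto
  ultimately have "2 < card (verts B - {w})" by simp
  moreover have "reach ?E p q" if "p \<in> verts B - {w}" "q \<in> verts B - {w}" for p q
    using that con(2)[of p q] reach_suppress[of "edges B" p q a ?E] by auto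
  moreover have "reach {f \<in> ?E. z \<notin> f} p q"
    if "z \<in> verts B - {w}" "p \<in> verts B - {w} - {z}" "q \<in> verts B - {w} - {z}" for z p q
  proof -
    \<comment> \<open>If \<open>z\<close> is one of \<open>a\<close>, \<open>b\<close>, then
      \<open>ab\<close> is lost, but so is the edge from \<open>w\<close> to \<open>z\<close>; the
      only edge left at \<open>w\<close> goes to \<open>c\<close>.\<close>
    obtain c where c: "c \<in> {a, b}" "c \<noteq> z" using a_neq_b by blast
    show ?thesis
    proof (rule reach_suppress[OF con(3)[of z p q] _ _ _ c(1)])
      fix s assume "s \<in> {a, b}" "{w, s} \<in> {f \<in> edges B. z \<notin> f}"
      then show "s = c \<or> {a, b} \<in> {f \<in> ?E. z \<notin> f}" using c by auto
    qed (use that in auto)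
  qed
  ultimately show ?thesis
    unfolding two_connected_iff[OF fin_simple_suppress] by (simp add: suppress_def)
qed

text \<open>A cycle together with a walk avoiding it lifts to \<open>B\<close>. At most one of them
  uses \<open>ab\<close>, and there \<open>ab\<close> is replaced by the path through
  \<open>w\<close>.\<close>

lemma cycles_separate_suppress:
  assumes good: "cycles_separate (edges B) x y"
  shows "cycles_separate (edges (suppress B w a b)) x y"
  unfolding cycles_separate_def
proof (intro allI impI notI, elim conjE)
  let ?E = "insert {a, b} {f \<in> edges B. w \<notin> f}"
  fix C assume C: "is_cyc C" "C \<subseteq> edges (suppress B w a b)"
    and "reach (edges (suppress B w a b) - C) x y"
  then have CE: "C \<subseteq> ?E" and r: "reach (?E - C) x y" by (simp_all add: suppress_def)
  have wC: "w \<notin> \<Union>C" using CE verts_ab by auto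
  show False
  proof (cases "{a, b} \<in> C")
    case False
    have "{a, w} \<in> edges B - C" "{w, b} \<in> edges B - C"
      using wa wb wC by (auto simp: insert_commute)
    then have awb: "reach (edges B - C) a b"
      by (meson converse_rtranclp_into_rtranclp r_into_rtranclp)
    have "reach (edges B - C) (id x) (id y)"
      using r
    proof (rule reach_map)
      fix p q assume pq: "{p, q} \<in> ?E - C"
      show "reach (edges B - C) (id p) (id q)"
      proof (cases "{p, q} = {a, b}")
        case True
        then show ?thesis using awb reach_sym[OF awb] by (auto simp: doubleton_eq_iff)
      next
        case False
        then have "{p, q} \<in> edges B - C" using pq by auto
        then show ?thesis by (simp add: r_into_rtranclp)
      qed
    qed
    moreover have "C \<subseteq> edges B" using CE False by auto
    ultimately show False using good C(1) unfolding cycles_separate_def by auto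
  next
    case True
    let ?C = "C - {{a, b}} \<union> {{a, w}, {w, b}}"
    have "is_cyc ?C" using is_cyc_subdivide[OF C(1) True wC] .
    moreover have "?C \<subseteq> edges B" using CE wa wb by (auto simp: insert_commute)
    \<comment> \<open>The walk uses neither \<open>ab\<close>, which belongs to \<open>C\<close>,
      nor any edge at \<open>w\<close>, so it misses the subdivided cycle.\<close>
    moreover have "?E - C \<subseteq> edges B - ?C" using True by auto
    with r have "reach (edges B - ?C) x y" by (rule reach_mono)
    ultimately show False using good unfolding cycles_separate_def by blast
  qed
qed

lemma edges_unsuppress:
  assumes "{a, b} \<notin> edges B"
  shows "edges (suppress B w a b) - {{a, b}} \<union> {{a, w}, {w, b}} = edges B"
proof -
  have "edges B = {f \<in> edges B. w \<notin> f} \<union> {f \<in> edges B. w \<in> f}" by auto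
  then show ?thesis using assms nbrs unfolding suppress_def by (auto simp: insert_commute)
qed

lemma cycle_unsuppress:
  assumes ab: "{a, b} \<notin> edges B" and "cycle_graph (suppress B w a b)"
  shows "cycle_graph B"
proof -
  let ?B = "suppress B w a b"
  have B: "is_cyc (edges ?B)" "verts B - {w} = \<Union>(edges ?B)"
    using assms(2) by (auto simp: cycle_graph_is_cyc suppress_def)
  have "is_cyc (edges B)"
  proof -
    have "{a, b} \<in> edges ?B" by (simp add: suppress_def)
    moreover have "w \<notin> \<Union>(edges ?B)" unfolding B(2)[symmetric] by simp
    ultimately show ?thesis using is_cyc_subdivide[OF B(1)] edges_unsuppress[OF ab] by metis
  qed
  moreover have "verts B = \<Union>(edges B)"
  proof
    show "\<Union>(edges B) \<subseteq> verts B" using fin_simple by (auto simp: fin_simple_graph_def)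
    show "verts B \<subseteq> \<Union>(edges B)"
    proof
      fix p assume p: "p \<in> verts B"
      then consider "p = w" | "p \<in> \<Union>(edges ?B)" using B(2) by blast
      then show "p \<in> \<Union>(edges B)"
      proof cases
        case 1 then show ?thesis using wa by blast
      next
        case 2 then show ?thesis using wa wb by (auto simp: suppress_def insert_commute)
      qed
    qed
  qed
  ultimately show ?thesis by (simp add: cycle_graph_is_cyc)
qed

text \<open>The same \<open>H\<close> works with one more subdivision step, at \<open>ab\<close>.
  That step leaves \<open>xy\<close> alone: \<open>ab\<close> is an edge of the suppressed graph and
  \<open>xy\<close> is not.\<close>

lemma three_connected_part_unsuppress:
  assumes ab: "{a, b} \<notin> edges B" and xy: "x \<noteq> w" "y \<noteq> w"
    and part: "three_connected_part (suppress B w a b) x y"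
    and nopair: "\<not> disjoint_cycle_pair_through (add_edge B {x, y}) {x, y}"
  shows "three_connected_part B x y"
proof -
  let ?B = "suppress B w a b"
  have nxy: "{x, y} \<notin> edges ?B" and "{x, y} \<noteq> {a, b}"
    using part unfolding three_connected_part_def by (auto simp: suppress_def)
  obtain H where H: "fin_simple_graph H" "k_connected 3 H" "subdivision_of H (add_edge ?B {x, y})"
    using part unfolding three_connected_part_def by blast
  have "subdivision_of H (Graph (insert w (verts (add_edge ?B {x, y})))
    (edges (add_edge ?B {x, y}) - {{a, b}} \<union> {{a, w}, {w, b}}))"
    by (rule subdivide[OF H(3) _ a_neq_b]) (auto simp: suppress_def add_edge_def)
  moreover have "edges (add_edge ?B {x, y}) - {{a, b}} \<union> {{a, w}, {w, b}} = insert {x, y} (edges B)"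
  proof -
    have "edges (add_edge ?B {x, y}) - {{a, b}} \<union> {{a, w}, {w, b}} =
      insert {x, y} (edges ?B - {{a, b}} \<union> {{a, w}, {w, b}})"
      using \<open>{x, y} \<noteq> {a, b}\<close>
      by (simp only: add_edge_def graph.sel insert_Diff_if singleton_iff if_False Un_insert_left)
    then show ?thesis by (simp only: edges_unsuppress[OF ab])
  qed
  moreover have "insert w (verts (add_edge ?B {x, y})) = verts B"
    using w by (auto simp: suppress_def add_edge_def)
  ultimately have "subdivision_of H (add_edge B {x, y})" by (simp add: add_edge_def)
  moreover have "{x, y} \<notin> edges B" using nxy xy by (auto simp: suppress_def)
  ultimately show ?thesis using H(1,2) nopair unfolding three_connected_part_def by blast
qed

end

lemma no_cycle_pair_of_cycles_separate:
  assumes "fin_simple_graph B" and "x \<in> verts B" "y \<in> verts B" "x \<noteq> y"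
    and "{x, y} \<notin> edges B" and "cycles_separate (edges B) x y"
  shows "\<not> disjoint_cycle_pair_through (add_edge B {x, y}) {x, y}"
proof -
  have "fin_simple_graph (add_edge B {x, y})"
    using assms by (auto simp: fin_simple_graph_def add_edge_def)
  then show ?thesis using disjoint_cycle_pair_iff[of "add_edge B {x, y}" x y] assms(5,6)
    by (simp add: add_edge_def)
qed

section \<open>Parts in which all vertices except the terminals have degree at least three\<close>

text \<open>Here \<open>B + xy\<close> itself is the 3-connected graph, with zero subdivision steps.
  Removing fewer than two vertices is covered by 2-connectedness, removing two by the cycle beside a
  separating pair.\<close>

lemma three_connected_part_min_degree:
  assumes B: "fin_simple_graph B" "k_connected 2 B"
    and xy: "x \<in> verts B" "y \<in> verts B" "x \<noteq> y" and good: "cycles_separate (edges B) x y"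
    and deg: "\<And>v. v \<in> verts B - {x, y} \<Longrightarrow> \<exists>p q r. p \<noteq> q \<and> p \<noteq> r \<and> q \<noteq> r \<and>
      {v, p} \<in> edges B \<and> {v, q} \<in> edges B \<and> {v, r} \<in> edges B"
  shows "three_connected_part B x y"
proof -
  note con = two_connectedD[OF B]
  have fin: "finite (verts B)" using B(1) by (simp add: fin_simple_graph_def)
  \<comment> \<open>Of three neighbours, at least two differ from any prescribed vertex
    \<open>c\<close>.\<close>
  have deg': "\<exists>p q. p \<noteq> q \<and> p \<noteq> v \<and> q \<noteq> v \<and> {v, p} \<in> edges B \<and> {v, q} \<in> edges B \<and>
      p \<in> verts B - {c} \<and> q \<in> verts B - {c}" if v: "v \<in> verts B - {x, y}" for v c
  proof -
    obtain p q r where "p \<noteq> q" "p \<noteq> r" "q \<noteq> r" "{v, p} \<in> edges B" "{v, q} \<in> edges B" "{v, r} \<in> edges B"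
      using deg[OF v] by blast
    moreover from this have "p \<in> verts B" "q \<in> verts B" "r \<in> verts B" "v \<noteq> p" "v \<noteq> q" "v \<noteq> r"
      using fin_simple_edgeD[OF B(1)] by metis+
    ultimately show ?thesis by (metis DiffI singletonD)
  qed
  obtain t where t: "t \<in> verts B - {x, y}" using ex_other_vertex[OF con(1), of x y] by blast
  \<comment> \<open>There is a cycle avoiding \<open>y\<close>, and it would leave the edge
    \<open>xy\<close> as a path between the terminals.\<close>
  have nxy: "{x, y} \<notin> edges B"
  proof
    assume e: "{x, y} \<in> edges B"
    obtain C where C: "is_cyc C" "C \<subseteq> edges B" "\<Union>C \<subseteq> insert x (verts B - {x, y})"
      by (rule cycle_exists[of "verts B - {x, y}" "edges B" x])
        (use deg'[where c = y] t fin in \<open>blast+\<close>)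
    have "{x, y} \<in> edges B - C" using e C(3) xy(3) by auto
    then show False using good C unfolding cycles_separate_def by blast
  qed
  let ?F = "add_edge B {x, y}"
  have card: "3 < card (verts B)"
  proof -
    obtain p q r where pqr: "p \<noteq> q" "p \<noteq> r" "q \<noteq> r" "{t, p} \<in> edges B" "{t, q} \<in> edges B" "{t, r} \<in> edges B"
      using deg[OF t] by blast
    then have in_B: "p \<in> verts B" "q \<in> verts B" "r \<in> verts B" "t \<noteq> p" "t \<noteq> q" "t \<noteq> r"
      using fin_simple_edgeD[OF B(1)] by metis+
    have "card {t, p, q, r} \<le> card (verts B)" using fin t in_B by (intro card_mono) auto
    then show ?thesis using pqr in_B by simp
  qed
  have "connected_graph (del_verts ?F X)" if X: "X \<subseteq> verts B" "card X < 3" for X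
  proof (cases "card X < 2")
    case True
    then have c: "connected_graph (del_verts B X)" using B(2) X(1) unfolding k_connected_def by blast
    have "reach {f \<in> edges B. f \<inter> X = {}} p q \<Longrightarrow> reach {f \<in> insert {x, y} (edges B). f \<inter> X = {}} p q"
      for p q by (erule reach_mono) auto
    then show ?thesis using c
      unfolding connected_graph_def del_verts_def add_edge_def by auto
  next
    case False
    then have "card X = 2" using X(2) by simp
    then obtain a b where ab: "X = {a, b}" "a \<noteq> b" by (auto simp: card_2_iff)
    let ?R = "{f \<in> insert {x, y} (edges B). f \<inter> X = {}}"
    \<comment> \<open>A component that misses both terminals after the deletion of
      \<open>{a, b}\<close> is impossible: together with \<open>a\<close> it carries a cycle, while
      \<open>x\<close> and \<open>y\<close> are joined outside it.\<close>
    have no_side: False if p: "p \<in> verts B - X" and q: "q \<in> verts B - X" "\<not> reach ?R p q"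
      and nx: "\<not> (x \<notin> X \<and> reach ?R p x)" and ny: "\<not> (y \<notin> X \<and> reach ?R p y)" for p q
    proof -
      define S where "S = {v \<in> verts B - X. reach ?R p v}"
      define T where "T = verts B - X - S"
      have ST: "{s, t} \<notin> edges B" if "s \<in> S" "t \<in> T" for s t
      proof
        assume "{s, t} \<in> edges B"
        then have "{s, t} \<in> ?R" using that unfolding S_def T_def by auto
        then have "reach ?R p t" using that(1) unfolding S_def
          by (auto intro: rtranclp.rtrancl_into_rtrancl)
        then show False using that(2) unfolding S_def T_def by auto
      qed
      have Sxy: "x \<notin> S" "y \<notin> S" using nx ny unfolding S_def by auto
      obtain C where C: "is_cyc C" "C \<subseteq> edges B" "\<Union>C \<subseteq> insert a S"
      proof (rule cycle_exists[of S "edges B" a])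
        show "finite S" "S \<noteq> {}" using fin p unfolding S_def by auto
        fix s assume s: "s \<in> S"
        then have "s \<in> verts B - {x, y}" using Sxy unfolding S_def by auto
        from deg'[OF this, of b] obtain r r' where r: "r \<noteq> r'" "r \<noteq> s" "r' \<noteq> s"
          "{s, r} \<in> edges B" "{s, r'} \<in> edges B" "r \<in> verts B - {b}" "r' \<in> verts B - {b}" by blast
        \<comment> \<open>All neighbours of a vertex of \<open>S\<close> lie in \<open>S\<close> or
          in the pair, and \<open>b\<close> was excluded beforehand.\<close>
        then have "r \<in> insert a S" "r' \<in> insert a S" using ST[OF s] ab unfolding T_def by blast+
        with r show "\<exists>p q. p \<noteq> q \<and> p \<noteq> s \<and> q \<noteq> s \<and> {s, p} \<in> edges B \<and> {s, q} \<in> edges B \<and>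
          p \<in> insert a S \<and> q \<in> insert a S" by blast
      qed blast
      have "reach {f \<in> edges B. f \<inter> S = {} \<and> f \<noteq> {a, b}} x y"
      proof (rule reach_beside_separation[OF B])
        show "verts B = S \<union> T \<union> {a, b}" "S \<inter> T = {}" "a \<notin> S \<union> T" "b \<notin> S \<union> T"
          using X(1) ab unfolding T_def S_def by auto
        show "T \<noteq> {}" using q unfolding T_def S_def by auto
        show "x \<in> T \<union> {a, b}" "y \<in> T \<union> {a, b}" using Sxy xy ab unfolding T_def by auto
        show "{t, s} \<notin> edges B" if "s \<in> S" "t \<in> T" for s t
          using ST[OF that] by (simp add: insert_commute)
      qed (rule ab(2))
      \<comment> \<open>Of the two distinct ends of an edge of \<open>C\<close> only one can be
        \<open>a\<close>, so the edge meets \<open>S\<close>, which the path avoids.\<close>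
      moreover have "f \<inter> S \<noteq> {}" if f: "f \<in> C" for f
      proof -
        obtain p q where "p \<noteq> q" "f = {p, q}" using is_cyc_edge_subset[OF C(1) f] by blast
        moreover from this have "p \<in> insert a S" "q \<in> insert a S" using C(3) f by blast+
        ultimately show ?thesis by auto
      qed
      then have "{f \<in> edges B. f \<inter> S = {} \<and> f \<noteq> {a, b}} \<subseteq> edges B - C" by blast
      ultimately have "reach (edges B - C) x y" by (rule reach_mono)
      then show False using good C unfolding cycles_separate_def by blast
    qed
    \<comment> \<open>The components of \<open>p\<close> and of \<open>q\<close> each contain a
      terminal, and the added edge joins the terminals if both survive.\<close>
    have "reach ?R p q" if pq: "p \<in> verts B - X" "q \<in> verts B - X" for p q
    proof (rule ccontr)
      assume n: "\<not> reach ?R p q"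
      have n': "\<not> reach ?R q p" using n by (rule contrapos_nn) (rule reach_sym)
      have xy_R: "reach ?R x y" "reach ?R y x" if "x \<notin> X" "y \<notin> X"
      proof -
        have "{x, y} \<in> ?R" using that by simp
        then show "reach ?R x y" by (rule r_into_rtranclp)
        then show "reach ?R y x" by (rule reach_sym)
      qed
      obtain v where v: "v \<in> {x, y}" "v \<notin> X" "reach ?R p v" using no_side[OF pq n] by blast
      obtain v' where v': "v' \<in> {x, y}" "v' \<notin> X" "reach ?R q v'" using no_side[OF pq(2,1) n'] by blast
      have "reach ?R v v'" using v v' xy_R by auto
      then have "reach ?R p q" using v(3) v'(3) by (blast intro: reach_trans reach_sym)
      then show False using n by contradiction
    qed
    moreover have "verts B - X \<noteq> {}"
    proof
      assume "verts B - X = {}"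
      then have "verts B = X" using X(1) by blast
      then show False using card \<open>card X = 2\<close> by simp
    qed
    ultimately show ?thesis unfolding connected_graph_def del_verts_def add_edge_def by auto
  qed
  then have "k_connected 3 ?F" using card unfolding k_connected_def add_edge_def by simp
  moreover have "fin_simple_graph ?F" using B(1) xy by (auto simp: fin_simple_graph_def add_edge_def)
  ultimately show ?thesis unfolding three_connected_part_def
    using nxy no_cycle_pair_of_cycles_separate[OF B(1) xy nxy good] subdivision_of.refl by blast
qed

text \<open>Induction on the number of vertices. A non-terminal vertex of degree two either closes a
  triangle or is suppressed and later reinserted; if there is none, all non-terminals have degree at
  least three.\<close>

lemma two_connected_chain_part:
  assumes "fin_simple_graph B" and "k_connected 2 B"
    and "x \<in> verts B" and "y \<in> verts B" and "x \<noteq> y" and "cycles_separate (edges B) x y"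
  shows "cycle_graph B \<or> three_connected_part B x y"
  using assms
proof (induction "card (verts B)" arbitrary: B rule: less_induct)
  case less
  note B = less.prems(1,2) and xy = less.prems(3-5) and good = less.prems(6)
  show ?case
  proof (cases "\<exists>w\<in>verts B - {x, y}. \<exists>a b. a \<noteq> b \<and> {f \<in> edges B. w \<in> f} = {{w, a}, {w, b}}")
    case True
    then obtain w a b where wab: "w \<in> verts B" "w \<noteq> x" "w \<noteq> y" "a \<noteq> b"
      "{f \<in> edges B. w \<in> f} = {{w, a}, {w, b}}" by blast
    interpret degree_two_vertex B w a b by (rule degree_two_vertex.intro[OF B wab(1,4,5)])
    show ?thesis
    proof (cases "{a, b} \<in> edges B")
      case True
      then show ?thesis using triangle[OF xy(1,2) wab(2,3)[symmetric] good] by simp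
    next
      case ab: False
      have "finite (verts B)" using B(1) by (simp add: fin_simple_graph_def)
      then have "card (verts (suppress B w a b)) < card (verts B)"
        using card_Diff1_less[OF _ wab(1)] by (simp add: suppress_def del: card_Diff_singleton)
      moreover have "x \<in> verts (suppress B w a b)" "y \<in> verts (suppress B w a b)"
        using xy wab by (simp_all add: suppress_def)
      ultimately have "cycle_graph (suppress B w a b) \<or> three_connected_part (suppress B w a b) x y"
        by (rule less.hyps[OF _ fin_simple_suppress two_connected_suppress[OF ab] _ _ xy(3)
          cycles_separate_suppress[OF good]])
      then show ?thesis
      proof
        assume "cycle_graph (suppress B w a b)"
        then show ?thesis using cycle_unsuppress[OF ab] by simp
      next
        assume part: "three_connected_part (suppress B w a b) x y"
        then have "{x, y} \<notin> edges (suppress B w a b)" by (simp add: three_connected_part_def)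
        then have "{x, y} \<notin> edges B" using wab(2,3) by (simp add: suppress_def)
        then have "\<not> disjoint_cycle_pair_through (add_edge B {x, y}) {x, y}"
          using no_cycle_pair_of_cycles_separate[OF B(1) xy _ good] by simp
        then show ?thesis
          using three_connected_part_unsuppress[OF ab wab(2,3)[symmetric] part] by simp
      qed
    qed
  next
    case False
    have deg: "\<exists>p q r. p \<noteq> q \<and> p \<noteq> r \<and> q \<noteq> r \<and>
      {v, p} \<in> edges B \<and> {v, q} \<in> edges B \<and> {v, r} \<in> edges B" if v: "v \<in> verts B - {x, y}" for v
    proof -
      obtain a b where ab: "a \<noteq> b" "{v, a} \<in> edges B" "{v, b} \<in> edges B"
        using two_connected_neighbours[OF B, of v] v by blast
      have "{f \<in> edges B. v \<in> f} \<noteq> {{v, a}, {v, b}}" using False v ab(1) by blast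
      then obtain f where f: "f \<in> edges B" "v \<in> f" "f \<noteq> {v, a}" "f \<noteq> {v, b}" using ab by auto
      have "card f = 2" using B(1) f(1) by (simp add: fin_simple_graph_def)
      then obtain p q where "f = {p, q}" by (auto simp: card_2_iff)
      then obtain c where c: "f = {v, c}" using f(2) by (auto simp: insert_commute)
      then have "c \<noteq> a" "c \<noteq> b" using f(3,4) by auto
      then show ?thesis using ab c f(1) by (intro exI[of _ a] exI[of _ b] exI[of _ c]) simp
    qed
    show ?thesis using three_connected_part_min_degree[OF B xy good deg] by simp
  qed
qed

section \<open>Decomposition into a chain\<close>

text \<open>The invariant for splitting at cut vertices: deleting any vertex leaves every other one
  joined to a terminal, so the blocks line up between \<open>x\<close> and \<open>y\<close>. If the
  deleted vertex is \<open>x\<close>, the first alternative is impossible and everything else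
  reaches \<open>y\<close>.\<close>

definition linked :: "'a graph \<Rightarrow> 'a \<Rightarrow> 'a \<Rightarrow> bool" where
  "linked K x y \<longleftrightarrow> fin_simple_graph K \<and> x \<in> verts K \<and> y \<in> verts K \<and> x \<noteq> y \<and>
     (\<forall>p\<in>verts K. \<forall>q\<in>verts K. reach (edges K) p q) \<and>
     (\<forall>v\<in>verts K. \<forall>w\<in>verts K - {v}.
        reach {f \<in> edges K. v \<notin> f} w x \<or> reach {f \<in> edges K. v \<notin> f} w y)"

lemma linkedD:
  assumes "linked K x y"
  shows "fin_simple_graph K" "x \<in> verts K" "y \<in> verts K" "x \<noteq> y"
    "\<And>p q. p \<in> verts K \<Longrightarrow> q \<in> verts K \<Longrightarrow> reach (edges K) p q"
    "\<And>v w. v \<in> verts K \<Longrightarrow> w \<in> verts K \<Longrightarrow> w \<noteq> v \<Longrightarrow>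
      reach {f \<in> edges K. v \<notin> f} w x \<or> reach {f \<in> edges K. v \<notin> f} w y"
  using assms unfolding linked_def by auto

lemma linked_sym: "linked K x y \<Longrightarrow> linked K y x"
  unfolding linked_def by blast

text \<open>On the side of \<open>x\<close>, the cut vertex \<open>v\<close> takes over the role of
  \<open>y\<close>, because every walk from this side to \<open>y\<close> passes through
  \<open>v\<close>.\<close>

lemma linked_side:
  assumes K: "linked K x y"
    and V: "verts K = insert v (S \<union> T)" "v \<notin> S \<union> T" "S \<inter> T = {}" and xy: "x \<in> S" "y \<in> T"
    and sep: "\<And>f. f \<in> edges K \<Longrightarrow> f \<subseteq> insert v S \<or> f \<subseteq> insert v T"
  shows "linked (Graph (insert v S) {f \<in> edges K. f \<subseteq> insert v S}) x v"
proof -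
  define E1 where "E1 = {f \<in> edges K. f \<subseteq> insert v S}"
  define E2 where "E2 = {f \<in> edges K. f \<subseteq> insert v T}"
  have E: "edges K \<subseteq> E1 \<union> E2" using sep unfolding E1_def E2_def by auto
  have E1: "\<Union>E1 \<subseteq> insert v S" and E2: "\<Union>E2 \<subseteq> insert v T" unfolding E1_def E2_def by auto
  have i: "\<Union>E1 \<inter> \<Union>E2 \<subseteq> {v}" using E1 E2 V(3) by auto
  have side: "reach (F \<inter> E1) w v \<or> reach (F \<inter> E1) w t"
    if "reach F w t" "F \<subseteq> edges K" "w \<in> insert v S" for F w t
  proof -
    have "w \<notin> \<Union>E2 - {v}" using that(3) E2 V(3) by auto
    then show ?thesis using reach_split[OF that(1) _ i] that(2) E by blast
  qed
  have not_y: "\<not> reach (F \<inter> E1) w y" if "w \<in> insert v S" for F w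
  proof
    assume r: "reach (F \<inter> E1) w y"
    have "w \<noteq> y" "y \<notin> insert v S" using that xy(2) V(2,3) by auto
    then show False using reach_vertex[OF r] E1 by blast
  qed
  have to_v: "reach E1 w v" if w: "w \<in> insert v S" for w
  proof -
    have "reach (edges K) w y" using linkedD(5)[OF K, of w y] w V(1) xy(2) by blast
    then have "reach (edges K \<inter> E1) w v" using side w not_y by blast
    then show ?thesis by (rule reach_mono) simp
  qed
  have "reach {f \<in> E1. z \<notin> f} w x \<or> reach {f \<in> E1. z \<notin> f} w v"
    if z: "z \<in> insert v S" and w: "w \<in> insert v S" "w \<noteq> z" for z w
  proof -
    let ?F = "{f \<in> edges K. z \<notin> f}"
    have "z \<in> verts K" "w \<in> verts K" using z w V(1) by auto
    then have "reach ?F w x \<or> reach ?F w y" using linkedD(6)[OF K] w(2) by simp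
    then have "reach (?F \<inter> E1) w v \<or> reach (?F \<inter> E1) w x"
      using side[of ?F w] w(1) not_y[OF w(1)] by blast
    moreover have "?F \<inter> E1 = {f \<in> E1. z \<notin> f}" unfolding E1_def by auto
    ultimately show ?thesis by auto
  qed
  moreover have "reach E1 p q" if "p \<in> insert v S" "q \<in> insert v S" for p q
    using reach_trans[OF to_v[OF that(1)] reach_sym[OF to_v[OF that(2)]]] .
  moreover have "fin_simple_graph (Graph (insert v S) E1)"
    using linkedD(1)[OF K] V(1) unfolding fin_simple_graph_def E1_def by simp
  moreover have "x \<noteq> v" using xy(1) V(2) by auto
  ultimately show ?thesis unfolding linked_def E1_def[symmetric] using xy(1) by auto
qed

text \<open>A walk from \<open>x\<close> to \<open>v\<close> avoiding a cycle in \<open>E1\<close>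
  could be prolonged to \<open>y\<close> through \<open>E2\<close>, which is disjoint from that
  cycle.\<close>

lemma cycles_separate_side:
  assumes good: "cycles_separate (E1 \<union> E2) x y" and r: "reach E2 v y" and disj: "E1 \<inter> E2 = {}"
  shows "cycles_separate E1 x v"
  unfolding cycles_separate_def
proof (intro allI impI notI, elim conjE)
  fix C assume C: "is_cyc C" "C \<subseteq> E1" and "reach (E1 - C) x v"
  then have "reach (E1 \<union> E2 - C) x v" by (elim reach_mono) auto
  moreover have "E2 \<subseteq> E1 \<union> E2 - C" using C(2) disj by auto
  then have "reach (E1 \<union> E2 - C) v y" using r by (rule reach_mono[rotated])
  ultimately have "reach (E1 \<union> E2 - C) x y" by (rule reach_trans)
  then show False using good C unfolding cycles_separate_def by blast
qed

section \<open>Concatenating chains\<close>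

lemma chainD:
  assumes "chain K n H u"
  shows "1 \<le> n" "K = graph_Union {1..n} H" "inj_on u {0..n}"
    "\<And>i. i \<in> {1..n} \<Longrightarrow> fin_simple_graph (H i)"
    "\<And>i. i \<in> {1..n} \<Longrightarrow> chain_part (H i) (u (i - 1)) (u i)"
    "\<And>i j. i \<in> {1..n} \<Longrightarrow> j \<le> n \<Longrightarrow> u j \<in> verts (H i) \<longleftrightarrow> j = i - 1 \<or> j = i"
    "\<And>i j. 1 \<le> i \<Longrightarrow> i < j \<Longrightarrow> j \<le> n \<Longrightarrow>
       verts (H i) \<inter> verts (H j) \<subseteq> (if j = i + 1 then {u i} else {})"
  using assms unfolding chain_def by auto

lemma chain_verts:
  assumes "chain K n H u"
  shows "i \<in> {1..n} \<Longrightarrow> verts (H i) \<subseteq> verts K" "j \<le> n \<Longrightarrow> u j \<in> verts K"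
proof -
  show *: "verts (H i) \<subseteq> verts K" if "i \<in> {1..n}" for i
    using that unfolding chainD(2)[OF assms] graph_Union_def by auto
  show "u j \<in> verts K" if j: "j \<le> n"
  proof (cases "j = 0")
    case True
    have "u 0 \<in> verts (H 1)" using chainD(6)[OF assms, of 1 0] chainD(1)[OF assms] by simp
    then show ?thesis using *[of 1] chainD(1)[OF assms] True by auto
  next
    case False
    have "u j \<in> verts (H j)" using chainD(6)[OF assms, of j j] j False by simp
    then show ?thesis using *[of j] j False by auto
  qed
qed

lemma chain_append:
  assumes 1: "chain K1 n1 H1 u1" and 2: "chain K2 n2 H2 u2"
    and V: "verts K1 \<inter> verts K2 = {v}" and v: "u1 n1 = v" "u2 0 = v"
  defines "H \<equiv> \<lambda>i. if i \<le> n1 then H1 i else H2 (i - n1)"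
    and "u \<equiv> \<lambda>i. if i \<le> n1 then u1 i else u2 (i - n1)"
  shows "chain (Graph (verts K1 \<union> verts K2) (edges K1 \<union> edges K2)) (n1 + n2) H u"
proof -
  have uL: "u i = u1 i" "H i = H1 i" if "i \<le> n1" for i using that unfolding u_def H_def by auto
  \<comment> \<open>This includes \<open>k = 0\<close>, since both chains have \<open>v\<close> at
    the junction. For the parts, numbered from 1, the shift is valid only from \<open>k = 1\<close>
    on.\<close>
  have uR: "u (n1 + k) = u2 k" for k using v unfolding u_def by (cases k) auto
  have HR: "H (n1 + k) = H2 k" if "1 \<le> k" for k using that unfolding H_def by auto
  have range: thesis if "i \<le> n1 + n2" "i \<le> n1 \<Longrightarrow> thesis"
    "\<And>k. i = n1 + k \<Longrightarrow> 1 \<le> k \<Longrightarrow> k \<le> n2 \<Longrightarrow> thesis" for i thesis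
    using that(1) that(2) that(3)[of "i - n1"] by linarith
  note verts1 = chain_verts[OF 1] and verts2 = chain_verts[OF 2]
  have inj1: "i = j" if "u1 i = u1 j" "i \<le> n1" "j \<le> n1" for i j
    using inj_onD[OF chainD(3)[OF 1] that(1)] that by simp
  have inj2: "i = j" if "u2 i = u2 j" "i \<le> n2" "j \<le> n2" for i j
    using inj_onD[OF chainD(3)[OF 2] that(1)] that by simp
  have u1_K2: "i = n1" if "u1 i \<in> verts K2" "i \<le> n1" for i
  proof -
    have "u1 i = u1 n1" using that verts1(2)[of i] V v by auto
    then show ?thesis using inj1 that by simp
  qed
  have u2_K1: "k = 0" if "u2 k \<in> verts K1" "k \<le> n2" for k
  proof -
    have "u2 k = u2 0" using that verts2(2)[of k] V v by auto
    then show ?thesis using inj2 that by simp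
  qed
  have Un: "(\<Union>i\<in>{1..n1 + n2}. g (H i)) = (\<Union>i\<in>{1..n1}. g (H1 i)) \<union> (\<Union>i\<in>{1..n2}. g (H2 i))"
    for g :: "'a graph \<Rightarrow> 'b set"
  proof -
    have "{1..n1 + n2} = {1..n1} \<union> (\<lambda>k. n1 + k) ` {1..n2}"
    proof (intro equalityI subsetI)
      fix i assume i: "i \<in> {1..n1 + n2}"
      then have "i \<le> n1 + n2" by simp
      then show "i \<in> {1..n1} \<union> (\<lambda>k. n1 + k) ` {1..n2}" by (rule range) (use i in auto)
    qed auto
    moreover have "(\<Union>i\<in>{1..n1}. g (H i)) = (\<Union>i\<in>{1..n1}. g (H1 i))" using uL by simp
    moreover have "(\<Union>k\<in>{1..n2}. g (H (n1 + k))) = (\<Union>i\<in>{1..n2}. g (H2 i))" using HR by simp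
    ultimately show ?thesis by (simp only: image_Un image_image Union_Un_distrib)
  qed
  show ?thesis unfolding chain_def
  proof (intro conjI ballI allI impI)
    show "1 \<le> n1 + n2" using chainD(1)[OF 1] by simp
    show "Graph (verts K1 \<union> verts K2) (edges K1 \<union> edges K2) = graph_Union {1..n1 + n2} H"
      unfolding chainD(2)[OF 1] chainD(2)[OF 2] graph_Union_def Un by simp
    show "inj_on u {0..n1 + n2}"
    proof (rule linorder_inj_onI')
      fix i j assume "i \<in> {0..n1 + n2}" "j \<in> {0..n1 + n2}" and ij: "i < j"
      then have i: "i \<le> n1 + n2" and j: "j \<le> n1 + n2" by simp_all
      show "u i \<noteq> u j"
      proof (rule range[OF i]; rule range[OF j])
        assume "i \<le> n1" "j \<le> n1"
        then show "u i \<noteq> u j" using uL inj1 ij by fastforce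
      next
        fix k assume "i \<le> n1" and k: "j = n1 + k" "1 \<le> k" "k \<le> n2"
        then show "u i \<noteq> u j" using u2_K1[of k] verts1(2)[of i] uL uR by auto
      next
        fix k assume "i = n1 + k" "j \<le> n1" then show "u i \<noteq> u j" using ij by simp
      next
        fix k l assume "i = n1 + k" "k \<le> n2" "j = n1 + l" "l \<le> n2"
        then show "u i \<noteq> u j" using uR inj2[of k l] ij by auto
      qed
    qed
  next
    fix i assume i': "i \<in> {1..n1 + n2}"
    then have i: "i \<le> n1 + n2" by simp
    show "fin_simple_graph (H i)"
    proof (rule range[OF i])
      assume "i \<le> n1" then show ?thesis using chainD(4)[OF 1, of i] uL i' by simp
    next
      fix k assume "i = n1 + k" "1 \<le> k" "k \<le> n2"
      then show ?thesis using chainD(4)[OF 2, of k] HR by simp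
    qed
    show "chain_part (H i) (u (i - 1)) (u i)"
    proof (rule range[OF i])
      assume "i \<le> n1" then show ?thesis using chainD(5)[OF 1, of i] uL[of i] uL[of "i - 1"] i' by simp
    next
      fix k assume k: "i = n1 + k" "1 \<le> k" "k \<le> n2"
      then have "i - 1 = n1 + (k - 1)" by simp
      then have "u (i - 1) = u2 (k - 1)" using uR by metis
      then show ?thesis using chainD(5)[OF 2, of k] HR uR k by simp
    qed
    fix j assume j: "j \<le> n1 + n2"
    show "u j \<in> verts (H i) \<longleftrightarrow> j = i - 1 \<or> j = i"
    proof (rule range[OF i]; rule range[OF j])
      assume "i \<le> n1" "j \<le> n1"
      then show ?thesis using chainD(6)[OF 1, of i j] uL i' by simp
    next
      fix k assume k: "i \<le> n1" "j = n1 + k" "1 \<le> k" "k \<le> n2"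
      then have "u2 k \<notin> verts (H1 i)" using u2_K1[of k] verts1(1)[of i] i' by auto
      then show ?thesis using k uL uR by simp
    next
      fix k assume k: "i = n1 + k" "1 \<le> k" "k \<le> n2" "j \<le> n1"
      show ?thesis
      proof (cases "j = n1")
        case True
        \<comment> \<open>The junction is terminal 0 of the second chain, so only the first part of
          that chain contains it.\<close>
        have "u2 0 \<in> verts (H2 k) \<longleftrightarrow> k = 1" using chainD(6)[OF 2, of k 0] k by auto
        then show ?thesis using True k uR[of 0] HR by auto
      next
        case False
        then have "u1 j \<notin> verts (H2 k)" using u1_K2[of j] verts2(1)[of k] k by auto
        then show ?thesis using k uL HR False by auto
      qed
    next
      fix k l assume k: "i = n1 + k" "1 \<le> k" "k \<le> n2" and l: "j = n1 + l" "1 \<le> l" "l \<le> n2"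
      then show ?thesis using chainD(6)[OF 2, of k l] uR HR by auto
    qed
  next
    fix i j assume ij: "1 \<le> i \<and> i < j \<and> j \<le> n1 + n2"
    then have i: "i \<le> n1 + n2" and j: "j \<le> n1 + n2" by simp_all
    show "verts (H i) \<inter> verts (H j) \<subseteq> (if j = i + 1 then {u i} else {})"
    proof (rule range[OF i]; rule range[OF j])
      assume "i \<le> n1" "j \<le> n1"
      then show ?thesis using chainD(7)[OF 1, of i j] uL ij by (cases "j = Suc i") simp_all
    next
      fix k assume k: "i \<le> n1" "j = n1 + k" "1 \<le> k" "k \<le> n2"
      have "verts (H1 i) \<subseteq> verts K1" "verts (H2 k) \<subseteq> verts K2" using verts1(1) verts2(1) k ij by auto
      then have sub: "verts (H i) \<inter> verts (H j) \<subseteq> {v}" using V k uL HR by auto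
      \<comment> \<open>Parts of different chains share at most \<open>v\<close>, which lies only in
        the last part of the first chain and the first part of the second.\<close>
      have "v \<in> verts (H1 i) \<Longrightarrow> i = n1" using chainD(6)[OF 1, of i n1] v k ij by auto
      moreover have "v \<in> verts (H2 k) \<Longrightarrow> k = 1" using chainD(6)[OF 2, of k 0] v k by auto
      ultimately have "v \<in> verts (H i) \<inter> verts (H j) \<Longrightarrow> j = i + 1 \<and> u i = v"
        using k uL HR v by auto
      then show ?thesis using sub by auto
    next
      fix k assume "i = n1 + k" "j \<le> n1" then show ?thesis using ij by simp
    next
      fix k l assume k: "i = n1 + k" "1 \<le> k" "k \<le> n2" and l: "j = n1 + l" "1 \<le> l" "l \<le> n2"
      have "H i = H2 k" "H j = H2 l" "u i = u2 k" "j = i + 1 \<longleftrightarrow> l = k + 1" using HR uR k l by simp_all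
      then show ?thesis using chainD(7)[OF 2, of k l] k l ij by (cases "l = k + 1") simp_all
    qed
  qed
qed

section \<open>Existence of a chain between the terminals\<close>

text \<open>Induction on the number of vertices. Without a cut vertex, \<open>K\<close> is a single
  part. Otherwise a cut vertex \<open>v\<close> separates \<open>x\<close> from \<open>y\<close>,
  and the chains of the two sides are concatenated at \<open>v\<close>.\<close>

lemma linked_chain:
  assumes "linked K x y" and "cycles_separate (edges K) x y"
  shows "\<exists>n H u. chain K n H u \<and> u 0 = x \<and> u n = y"
  using assms
proof (induction "card (verts K)" arbitrary: K x y rule: less_induct)
  case less
  note K = less.prems(1) and good = less.prems(2)
  note KD = linkedD[OF K]
  have fin: "finite (verts K)" using KD(1) by (simp add: fin_simple_graph_def)
  show ?case
  proof (cases "\<forall>z\<in>verts K. \<forall>p\<in>verts K - {z}. \<forall>q\<in>verts K - {z}. reach {f \<in> edges K. z \<notin> f} p q")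
    case True
    have "chain_part K x y"
    proof (cases "verts K = {x, y}")
      case True
      then have "single_edge_part K x y"
        using KD(5) unfolding single_edge_part_def connected_graph_def by auto
      then show ?thesis by (simp add: chain_part_def)
    next
      case False
      have "{x, y} \<subset> verts K" using False KD(2,3) by blast
      then have "card {x, y} < card (verts K)" by (rule psubset_card_mono[OF fin])
      then have "2 < card (verts K)" using KD(4) by simp
      then have "k_connected 2 K" unfolding two_connected_iff[OF KD(1)] using KD(5) True by blast
      then have "cycle_graph K \<or> three_connected_part K x y"
        by (rule two_connected_chain_part[OF KD(1) _ KD(2,3,4) good])
      then show ?thesis unfolding chain_part_def by blast
    qed
    then have "chain K 1 (\<lambda>_. K) (\<lambda>i. if i = 0 then x else y)"
      unfolding chain_def graph_Union_def using KD(1-4) by (auto simp: inj_on_def le_Suc_eq)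
    then show ?thesis by (intro exI[of _ 1] exI[of _ "\<lambda>_. K"] exI[of _ "\<lambda>i. if i = 0 then x else y"]) simp
  next
    case False
    then obtain v p q where v: "v \<in> verts K" and pq: "p \<in> verts K - {v}" "q \<in> verts K - {v}"
      and cut: "\<not> reach {f \<in> edges K. v \<notin> f} p q" by blast
    let ?R = "{f \<in> edges K. v \<notin> f}"
    have split: "reach ?R w x \<or> reach ?R w y" if "w \<in> verts K - {v}" for w
      using KD(6)[OF v, of w] that by simp
    have not_v: "\<not> reach ?R w v" if "w \<noteq> v" for w using reach_vertex[of ?R w v] that by auto
    \<comment> \<open>A vertex reached from everywhere would connect the separated vertices
      \<open>p\<close> and \<open>q\<close>.\<close>
    have not_all: "\<exists>w\<in>verts K - {v}. \<not> reach ?R w t" for t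
    proof (rule ccontr)
      assume "\<not> ?thesis"
      then have r: "reach ?R p t" "reach ?R q t" using pq by blast+
      show False using cut reach_trans[OF r(1) reach_sym[OF r(2)]] by contradiction
    qed
    \<comment> \<open>If \<open>v\<close> were \<open>x\<close>, no other vertex could reach
      \<open>x\<close> without \<open>v\<close>, so all of them would reach
      \<open>y\<close>.\<close>
    have vx: "v \<noteq> x" using not_all[of y] split not_v by blast
    have vy: "v \<noteq> y" using not_all[of x] split not_v by blast
    have nxy: "\<not> reach ?R x y"
    proof
      assume r: "reach ?R x y"
      have "reach ?R w y" if "w \<in> verts K - {v}" for w using split[OF that] reach_trans[of ?R w x y, OF _ r] by auto
      then show False using not_all[of y] by blast
    qed
    define S where "S = {w \<in> verts K - {v}. reach ?R w x}"
    define T where "T = {w \<in> verts K - {v}. reach ?R w y}"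
    have V: "verts K = insert v (S \<union> T)" using split v unfolding S_def T_def by blast
    have vST: "v \<notin> S \<union> T" unfolding S_def T_def by simp
    have ST: "S \<inter> T = {}"
    proof (rule ccontr)
      assume "S \<inter> T \<noteq> {}"
      then obtain w where w: "reach ?R w x" "reach ?R w y" unfolding S_def T_def by auto
      show False using nxy reach_trans[OF reach_sym[OF w(1)] w(2)] by contradiction
    qed
    have xS: "x \<in> S" and yT: "y \<in> T" using KD(2,3) vx vy unfolding S_def T_def by auto
    have sep: "f \<subseteq> insert v S \<or> f \<subseteq> insert v T" if f: "f \<in> edges K" for f
    proof -
      have "card f = 2" using KD(1) f by (simp add: fin_simple_graph_def)
      then obtain a b where ab: "f = {a, b}" by (auto simp: card_2_iff)
      have abK: "a \<in> verts K" "b \<in> verts K" using fin_simple_edgeD[OF KD(1)] f ab by auto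
      show ?thesis
      proof (cases "v \<in> f")
        case True then show ?thesis using ab abK V by auto
      next
        case False
        then have "{a, b} \<in> ?R" using f ab by simp
        then have r1: "reach ?R a b" by (rule r_into_rtranclp)
        note r' = r1 reach_sym[OF r1]
        have r: "reach ?R a t \<longleftrightarrow> reach ?R b t" for t
          using reach_trans[OF r'(1), of t] reach_trans[OF r'(2), of t] by blast
        have "a \<noteq> v" "b \<noteq> v" using False ab by auto
        then have "a \<in> S \<longleftrightarrow> b \<in> S" "a \<in> T \<longleftrightarrow> b \<in> T" using r abK unfolding S_def T_def by auto
        then show ?thesis using ab abK V by auto
      qed
    qed
    let ?K1 = "Graph (insert v S) {f \<in> edges K. f \<subseteq> insert v S}"
    let ?K2 = "Graph (insert v T) {f \<in> edges K. f \<subseteq> insert v T}"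
    have L1: "linked ?K1 x v" by (rule linked_side[OF K V vST ST xS yT sep])
    have L2: "linked ?K2 v y"
    proof (rule linked_sym, rule linked_side[OF linked_sym[OF K] _ _ _ yT xS])
      show "verts K = insert v (T \<union> S)" "v \<notin> T \<union> S" "T \<inter> S = {}" using V vST ST by auto
      show "\<And>f. f \<in> edges K \<Longrightarrow> f \<subseteq> insert v T \<or> f \<subseteq> insert v S" using sep by blast
    qed
    have E: "edges K = edges ?K1 \<union> edges ?K2" using sep by auto
    have disj: "edges ?K1 \<inter> edges ?K2 = {}"
    proof (rule ccontr)
      assume "edges ?K1 \<inter> edges ?K2 \<noteq> {}"
      then obtain f where f: "f \<in> edges K" "f \<subseteq> insert v S" "f \<subseteq> insert v T" by auto
      then have "f \<subseteq> {v}" using ST by blast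
      then have "card f \<le> 1" using card_mono[of "{v}" f] by simp
      then show False using f(1) KD(1) by (auto simp: fin_simple_graph_def)
    qed
    have g1: "cycles_separate (edges ?K1) x v"
    proof (rule cycles_separate_side[OF _ _ disj])
      show "cycles_separate (edges ?K1 \<union> edges ?K2) x y" using good E by simp
      show "reach (edges ?K2) v y" by (rule linkedD(5)[OF L2 linkedD(2,3)[OF L2]])
    qed
    have g2: "cycles_separate (edges ?K2) v y"
    proof (rule cycles_separate_sym, rule cycles_separate_side)
      show "cycles_separate (edges ?K2 \<union> edges ?K1) y x" using cycles_separate_sym[OF good] E by (simp only: Un_commute)
      show "reach (edges ?K1) v x" by (rule linkedD(5)[OF L1 linkedD(3,2)[OF L1]])
      show "edges ?K2 \<inter> edges ?K1 = {}" using disj by (simp only: Int_commute)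
    qed
    have "verts ?K1 \<subset> verts K" "verts ?K2 \<subset> verts K" using V vST ST xS yT by auto
    then have lt: "card (verts ?K1) < card (verts K)" "card (verts ?K2) < card (verts K)"
      using psubset_card_mono[OF fin] by blast+
    obtain n1 H1 u1 where 1: "chain ?K1 n1 H1 u1" "u1 0 = x" "u1 n1 = v"
      using less.hyps[OF lt(1) L1 g1] by blast
    obtain n2 H2 u2 where 2: "chain ?K2 n2 H2 u2" "u2 0 = v" "u2 n2 = y"
      using less.hyps[OF lt(2) L2 g2] by blast
    have i: "verts ?K1 \<inter> verts ?K2 = {v}" using ST vST by auto
    have "Graph (verts ?K1 \<union> verts ?K2) (edges ?K1 \<union> edges ?K2) = K"
      using V E by (intro graph.expand) auto
    then have "chain K (n1 + n2) (\<lambda>i. if i \<le> n1 then H1 i else H2 (i - n1))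
      (\<lambda>i. if i \<le> n1 then u1 i else u2 (i - n1))"
      using chain_append[OF 1(1) 2(1) i 1(3) 2(2)] by simp
    moreover have "(if n1 + n2 \<le> n1 then u1 (n1 + n2) else u2 (n1 + n2 - n1)) = y"
      using chainD(1)[OF 2(1)] 2(3) by simp
    ultimately show ?thesis using 1(2)
      by (intro exI[of _ "n1 + n2"] exI[of _ "\<lambda>i. if i \<le> n1 then H1 i else H2 (i - n1)"]
        exI[of _ "\<lambda>i. if i \<le> n1 then u1 i else u2 (i - n1)"]) simp
  qed
qed

text \<open>Deleting \<open>x\<close> or \<open>y\<close> also removes the edge \<open>xy\<close>,
  so 2-connectedness of \<open>G\<close> applies directly. For any other \<open>v\<close>, a walk to
  \<open>x\<close> in \<open>G - v\<close> is stopped before it first uses \<open>xy\<close>, where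
  it stands at a terminal.\<close>

lemma linked_del_edge:
  assumes G: "fin_simple_graph G" "k_connected 2 G" and e: "{x, y} \<in> edges G"
  shows "linked (Graph (verts G) (edges G - {{x, y}})) x y"
proof -
  note con = two_connectedD[OF G]
  note xy = fin_simple_edgeD[OF G(1) e]
  let ?E = "edges G - {{x, y}}"
  have avoid: "reach {f \<in> ?E. z \<notin> f} p q"
    if "z \<in> {x, y}" "p \<in> verts G - {z}" "q \<in> verts G - {z}" for z p q
  proof -
    have "z \<in> verts G" using that xy by auto
    have "{f \<in> edges G. z \<notin> f} \<subseteq> {f \<in> ?E. z \<notin> f}" using that(1) by auto
    then show ?thesis by (rule reach_mono[OF con(3)[OF \<open>z \<in> verts G\<close> that(2,3)]])
  qed
  have avoid': "reach ?E p q" if "z \<in> {x, y}" "p \<in> verts G - {z}" "q \<in> verts G - {z}" for z p q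
    by (rule reach_mono[OF avoid[OF that]]) auto
  obtain t where t: "t \<in> verts G" "t \<noteq> x" "t \<noteq> y" using ex_other_vertex[OF con(1), of x y] by blast
  \<comment> \<open>A third vertex serves as hub: \<open>x\<close> reaches it avoiding
    \<open>y\<close>, every other vertex avoiding \<open>x\<close>.\<close>
  have to_t: "reach ?E p t" if "p \<in> verts G" for p
    using avoid'[of x p t] avoid'[of y p t] that t xy(3) by (cases "p = x") auto
  have "reach ?E p q" if "p \<in> verts G" "q \<in> verts G" for p q
    using reach_trans[OF to_t[OF that(1)] reach_sym[OF to_t[OF that(2)]]] .
  moreover have "reach {f \<in> ?E. v \<notin> f} w x \<or> reach {f \<in> ?E. v \<notin> f} w y"
    if v: "v \<in> verts G" and w: "w \<in> verts G" "w \<noteq> v" for v w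
  proof (cases "v \<in> {x, y}")
    case True
    then show ?thesis using avoid[of v w x] avoid[of v w y] w xy by auto
  next
    case False
    let ?F = "{f \<in> ?E. v \<notin> f}"
    have step: "reach ?F w r \<or> reach ?F w x \<or> reach ?F w y"
      if "reach {f \<in> edges G. v \<notin> f} w r" for r
      using that
    proof (induction rule: rtranclp_induct)
      case (step p q)
      show ?case
      proof (cases "{p, q} = {x, y}")
        case True
        then have "p \<in> {x, y}" by auto
        then show ?thesis using step.IH by auto
      next
        case False
        then have pq: "{p, q} \<in> ?F" using step.hyps(2) by simp
        have "reach ?F w q" if "reach ?F w p" using that pq by (rule rtranclp.rtrancl_into_rtrancl)
        then show ?thesis using step.IH by blast
      qed
    qed simp
    have "reach {f \<in> edges G. v \<notin> f} w x" using con(3)[OF v] w False xy(1) by auto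
    from step[OF this] show ?thesis by blast
  qed
  moreover have "fin_simple_graph (Graph (verts G) ?E)" using G(1) by (simp add: fin_simple_graph_def)
  ultimately show ?thesis unfolding linked_def using xy by simp
qed

section \<open>The equivalence for a 2-connected graph and one of its edges\<close>

theorem theorem1p5:
  fixes G :: "'a graph" and e :: "'a set"
  assumes "fin_simple_graph G" and "k_connected 2 G" and "e \<in> edges G"
  shows "\<not> disjoint_cycle_pair_through G e \<longleftrightarrow>
    (\<exists>n\<ge>1. \<exists>(H :: nat \<Rightarrow> 'a graph) (u :: nat \<Rightarrow> 'a).
       (\<forall>i\<in>{1..n}. subgraph (H i) G) \<and>
       u ` {0..n} \<subseteq> verts G \<and> inj_on u {0..n} \<and>
       (G = add_edge (graph_Union {1..n} H) e \<and> (\<forall>i\<in>{1..n}. e \<notin> edges (H i))) \<and>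
       e = {u 0, u n} \<and>
       (\<forall>i j. i < j \<and> j \<le> n \<and> {i, j} \<noteq> {0, n} \<and> j \<noteq> i + 1 \<longrightarrow> {u i, u j} \<notin> edges G) \<and>
       (\<forall>i\<in>{1..n}. verts (H i) \<inter> u ` {0..n} = {u (i - 1), u i}) \<and>
       (\<forall>i j. 1 \<le> i \<and> i < j \<and> j \<le> n \<longrightarrow>
          (j > i + 1 \<longrightarrow> verts (H i) \<inter> verts (H j) = {}) \<and>
          (j = i + 1 \<longrightarrow> verts (H i) \<inter> verts (H j) = {u i})) \<and>
       (\<forall>i\<in>{1..n}. single_edge_part (H i) (u (i - 1)) (u i) \<or>
          cycle_graph (H i) \<or>
          three_connected_part (H i) (u (i - 1)) (u i)))"
    (is "?L \<longleftrightarrow> (\<exists>n\<ge>1. \<exists>H u. ?R n H u)")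
proof
  assume ?L
  have "card e = 2" using assms(1,3) by (simp add: fin_simple_graph_def)
  then obtain x y where e: "e = {x, y}" by (auto simp: card_2_iff)
  let ?K = "Graph (verts G) (edges G - {{x, y}})"
  have good: "cycles_separate (edges ?K) x y"
    using \<open>?L\<close> disjoint_cycle_pair_iff[of G x y] assms(1,3) e by simp
  have "linked ?K x y" using linked_del_edge assms e by simp
  from linked_chain[OF this good] obtain n H u where c: "chain ?K n H u" and u: "u 0 = x" "u n = y"
    by blast
  note cD = chainD[OF c]
  have K: "verts G = (\<Union>i\<in>{1..n}. verts (H i))" "edges G - {e} = (\<Union>i\<in>{1..n}. edges (H i))"
    using cD(2) e by (simp_all add: graph_Union_def)
  have inj: "i = j" if "u i = u j" "i \<le> n" "j \<le> n" for i j
    using inj_onD[OF cD(3) that(1)] that by simp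
  have R: "?R n H u"
  proof (intro conjI ballI allI impI)
    show "subgraph (H i) G" if "i \<in> {1..n}" for i
      using that cD(4) K unfolding subgraph_def by blast
    show "u ` {0..n} \<subseteq> verts G" using chain_verts(2)[OF c] by auto
    show "inj_on u {0..n}" by (rule cD(3))
    show "e \<notin> edges (H i)" if "i \<in> {1..n}" for i using that K(2) by blast
    show "G = add_edge (graph_Union {1..n} H) e"
      using K assms(3) by (intro graph.expand) (auto simp: add_edge_def graph_Union_def)
    show "e = {u 0, u n}" using e u by simp
    show "verts (H i) \<inter> u ` {0..n} = {u (i - 1), u i}" if i: "i \<in> {1..n}" for i
      using cD(6)[OF i] i by (auto simp: image_iff)
    show "single_edge_part (H i) (u (i - 1)) (u i) \<or> cycle_graph (H i) \<or>
        three_connected_part (H i) (u (i - 1)) (u i)" if "i \<in> {1..n}" for i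
      using cD(5)[OF that] unfolding chain_part_def .
  next
    fix i j assume ij: "i < j \<and> j \<le> n \<and> {i, j} \<noteq> {0, n} \<and> j \<noteq> i + 1"
    show "{u i, u j} \<notin> edges G"
    proof
      assume uij: "{u i, u j} \<in> edges G"
      have "{u i, u j} \<noteq> e"
      proof
        assume "{u i, u j} = e"
        then have "u i = u 0 \<and> u j = u n \<or> u i = u n \<and> u j = u 0"
          using e u by (auto simp: doubleton_eq_iff)
        then show False using inj[of i 0] inj[of j n] inj[of i n] inj[of j 0] ij by auto
      qed
      \<comment> \<open>An edge other than \<open>e\<close> lies in a part, and the only terminals
        in a part are two consecutive ones.\<close>
      then obtain k where k: "k \<in> {1..n}" "{u i, u j} \<in> edges (H k)" using uij K(2) by blast
      have "u i \<in> verts (H k)" "u j \<in> verts (H k)" using fin_simple_edgeD[OF cD(4)[OF k(1)] k(2)] by simp_all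
      then have "i = k - 1 \<or> i = k" "j = k - 1 \<or> j = k" using cD(6)[OF k(1)] ij by auto
      then show False using ij k(1) by auto
    qed
  next
    fix i j assume ij: "1 \<le> i \<and> i < j \<and> j \<le> n"
    show "verts (H i) \<inter> verts (H j) = {}" if "j > i + 1" using cD(7)[of i j] ij that by auto
    show "verts (H i) \<inter> verts (H j) = {u i}" if j: "j = i + 1"
    proof -
      have "u i \<in> verts (H i)" "u i \<in> verts (H j)" using cD(6)[of i i] cD(6)[of j i] ij j by auto
      then show ?thesis using cD(7)[of i j] ij j by auto
    qed
  qed
  show "\<exists>n\<ge>1. \<exists>H u. ?R n H u"
    by (rule exI[of _ n], rule conjI[OF cD(1)], rule exI[of _ H], rule exI[of _ u], rule R)
next
  assume "\<exists>n\<ge>1. \<exists>H u. ?R n H u"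
  then obtain n where n: "1 \<le> n \<and> (\<exists>H u. ?R n H u)" ..
  then obtain H where "\<exists>u. ?R n H u" by (elim conjE exE[of "\<lambda>H. \<exists>u. ?R n H u"])
  then obtain u where R: "?R n H u" ..
  have sub: "\<forall>i\<in>{1..n}. subgraph (H i) G" using R by (elim conjE)
  have inj: "inj_on u {0..n}" using R by (elim conjE)
  have G: "G = add_edge (graph_Union {1..n} H) e" using R by (elim conjE)
  have e_nin: "\<forall>i\<in>{1..n}. e \<notin> edges (H i)" using R by (elim conjE)
  have e: "e = {u 0, u n}" using R by (elim conjE)
  have U: "\<forall>i\<in>{1..n}. verts (H i) \<inter> u ` {0..n} = {u (i - 1), u i}" using R by (elim conjE)
  have V: "\<forall>i j. 1 \<le> i \<and> i < j \<and> j \<le> n \<longrightarrow>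
      (j > i + 1 \<longrightarrow> verts (H i) \<inter> verts (H j) = {}) \<and>
      (j = i + 1 \<longrightarrow> verts (H i) \<inter> verts (H j) = {u i})" using R by (elim conjE)
  have part: "\<forall>i\<in>{1..n}. single_edge_part (H i) (u (i - 1)) (u i) \<or>
      cycle_graph (H i) \<or> three_connected_part (H i) (u (i - 1)) (u i)" using R by (elim conjE)
  \<comment> \<open>The given parts form a chain for the graph without \<open>e\<close>; gluing
    yields the separation property, and \<open>e\<close> is then put back.\<close>
  have "chain (graph_Union {1..n} H) n H u"
    unfolding chain_def
  proof (intro conjI ballI allI impI)
    fix i assume i: "i \<in> {1..n}"
    show "fin_simple_graph (H i)" using sub i by (simp add: subgraph_def)
    show "chain_part (H i) (u (i - 1)) (u i)" using part i by (simp add: chain_part_def)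
    fix j assume j: "j \<le> n"
    have "u j \<in> u ` {0..n}" using j by simp
    then have "u j \<in> verts (H i) \<longleftrightarrow> u j \<in> verts (H i) \<inter> u ` {0..n}" by simp
    also have "\<dots> \<longleftrightarrow> u j \<in> {u (i - 1), u i}" unfolding bspec[OF U i] ..
    also have "\<dots> \<longleftrightarrow> j = i - 1 \<or> j = i"
      using inj_on_eq_iff[OF inj, of j "i - 1"] inj_on_eq_iff[OF inj, of j i] i j by auto
    finally show "u j \<in> verts (H i) \<longleftrightarrow> j = i - 1 \<or> j = i" .
  next
    fix i j assume "1 \<le> i \<and> i < j \<and> j \<le> n"
    then show "verts (H i) \<inter> verts (H j) \<subseteq> (if j = i + 1 then {u i} else {})"
      using V by (cases "j = i + 1") auto
  qed (use n inj in simp_all)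
  then have good: "cycles_separate (edges (graph_Union {1..n} H)) (u 0) (u n)" by (rule cycles_separate_chain)
  have "edges G = insert e (edges (graph_Union {1..n} H))"
    by (subst G) (simp add: add_edge_def)
  moreover have "e \<notin> edges (graph_Union {1..n} H)" using e_nin by (simp add: graph_Union_def)
  ultimately have "edges G - {e} = edges (graph_Union {1..n} H)" by simp
  then show ?L using disjoint_cycle_pair_iff[of G "u 0" "u n"] assms(1,3) good e by simp
qed

end
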